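(* Let $k=(k_1,\dots,k_l)\in\mathbb{Z}_+^l$ be a partition of $n$ and let $h\in\mathbb{Z}_+^l$ satisfy $1\le h_j\le k_j-1$ for all $j$. Then for every $j=0,\dots,l$ and for every fiber $F$ of the quotient map $V_j\to G_j\backslash V_j$ (i.e. every $G_j$-orbit $F$ in $V_j$), the following hold. (i) The action of $\mathcal{T}_j$ restricted to $F$ defines a Riemannian foliation $\mathcal{O}_F$ of $F$ on whose leaves every symbol belonging to $\mathcal{A}_{k,h}$ is constant (where it is defined). (ii) The vector bundle $T\mathcal{O}_F^\perp$, defined as the orthogonal complement of $T\mathcal{O}_F$ inside $TF$, is integrable to a totally geodesic foliation $\mathcal{JO}_F$ of $F$. (iii) The pair $(\mathcal{O}_F,\mathcal{JO}_F)$ is a Lagrangian frame of the complex manifold $F$ for the Kähler structure on $F$ inherited from $\mathbb{P}^n(\mathbb{C})$.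
   Context: $\mathbb{Z}_+$ is the set of non-negative integers, $\mathbb{T}$ the unit circle. A partition of $n$ is $k=(k_1,\dots,k_l)$ with positive integer entries, $k_1\le\dots\le k_l$, $k_1+\dots+k_l=n$. $\mathbb{P}^n(\mathbb{C})$ carries the Fubini–Study Kähler structure; complex submanifolds carry the restricted Kähler structure. $\mathrm{PSL}(n+1,\mathbb{C})=\mathrm{SL}(n+1,\mathbb{C})/(\mathbb{T}I_{n+1}\cap\mathrm{SL}(n+1,\mathbb{C}))$, $[A]$ is the class of $A$, acting by $[A][w]=[Aw]$. Write $w\in\mathbb{C}^{n+1}=\mathbb{C}\times\mathbb{C}^{k_1}\times\dots\times\mathbb{C}^{k_l}$ as $w=(w_0=w_{(0)},w_{(1)},\dots,w_{(l)})$ and decompose multi-indices $p\in\mathbb{Z}_+^{n+1}$ likewise, with $(p_{(j)})_r$ the $r$-th entry of $p_{(j)}$. $V_0=\{[w]: w_0,w_{(1)},\dots,w_{(l)}\ne0\}$ and, for $j\ge1$, $V_j=\{[w]: w_{(j)},\dots,w_{(l)}\neq0,\ w_0=0,\dots,w_{(j-1)}=0\}$. $G_0$ is the group of classes $[A]\in\mathrm{PSL}(n+1,\mathbb{C})$ with $A$ block diagonal with blocks $(z_0,z_1I_{k_1},\dots,z_lI_{k_l})$, $z_i\in\mathbb{C}^*$, $z_0z_1^{k_1}\cdots z_l^{k_l}=1$. For $j=1,\dots,l$, $G_j\subset G_0$ is the subgroup of classes of block diagonal matrices with blocks $(z_0,I_{k_1},\dots,I_{k_{j-1}},z_jI_{k_j},\dots,z_lI_{k_l})$,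 $z_0,z_j,\dots,z_l\in\mathbb{C}^*$, $z_0z_j^{k_j}\cdots z_l^{k_l}=1$. $\mathcal{T}_k$ is the group of classes of block diagonal matrices with blocks $(\overline{t}_1^{k_1}\cdots\overline{t}_l^{k_l},t_1I_{k_1},\dots,t_lI_{k_l})$, $t_i\in\mathbb{T}$, and $\mathcal{T}_j=G_j\cap\mathcal{T}_k$. $\mathcal{A}_{k,h}$ is the set of functions $$\varphi([w])=a(|w_{(0)}|,\dots,|w_{(l)}|)\prod_{j=0}^l\left(\frac{w_{(j)}}{|w_{(j)}|}\right)^{p_{(j)}}\left(\frac{\overline{w}_{(j)}}{|w_{(j)}|}\right)^{q_{(j)}}$$ with $a$ homogeneous of degree $0$ and $p,q\in\mathbb{Z}_+^{n+1}$ satisfying $p\cdot q=0$, $|p_{(j)}|=|q_{(j)}|$ for all $j=0,\dots,l$ (where $|\cdot|$ is the sum of entries), and, for $j=1,\dots,l$, $(p_{(j)})_r=0$ for $h_j<r\le k_j$ and $(q_{(j)})_s=0$ for $1\le s\le h_j$. Such $\varphi$ is regarded as defined at $[w]$ with $w_{(j)}\ne0$ whenever $p_{(j)}\neq0$ or $q_{(j)}\ne0$. A Lagrangian frame on a Kähler manifold $N$ is a pair $(\mathcal{O},\mathfrak{F})$ of smooth foliations such that: the leaves of both are Lagrangian submanifolds of $N$; if $L_1,L_2$ are leaves of $\mathcal{O},\mathfrak{F}$ respectively, then $T_xL_1\perp T_xL_2$ at every $x\in L_1\cap L_2$; $\mathcal{O}$ is Riemannian (the Riemannian metric of $N$ is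 invariant under the leaf holonomy of $\mathcal{O}$); $\mathfrak{F}$ is totally geodesic (its leaves are totally geodesic submanifolds of $N$). The foliation defined by the $\mathcal{T}_j$-action is the one whose leaves are the $\mathcal{T}_j$-orbits. *)

theory Defs
  imports "HOL-Analysis.Analysis"
begin

section \<open>Smooth maps and submanifolds\<close>

text \<open>Manifolds are modelled as subsets of a Euclidean space \<open>'a\<close> carrying local
  parametrizations, with an arbitrary Riemannian metric \<open>g x u v\<close> and almost complex structure
  \<open>J x u\<close> on tangent vectors (not necessarily the ones induced by \<open>'a\<close>). Since the dimension of
  a manifold is a number and not a type, the parameter domains are relatively open subsets \<open>D\<close> of
  linear subspaces \<open>S\<close> of arbitrary dimension.\<close>

definition ddir :: "('a::real_normed_vector \<Rightarrow> 'b::real_normed_vector) \<Rightarrow> 'a \<Rightarrow> 'a \<Rightarrow> 'b" where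
  "ddir f x v = vector_derivative (\<lambda>t::real. f (x + t *\<^sub>R v)) (at 0)"

primrec Ck_on :: "nat \<Rightarrow> 'a::euclidean_space set \<Rightarrow> 'a set \<Rightarrow> ('a \<Rightarrow> 'b::real_normed_vector) \<Rightarrow> bool" where
  "Ck_on 0 S D f \<longleftrightarrow> continuous_on D f"
| "Ck_on (Suc m) S D f \<longleftrightarrow> f differentiable_on D \<and> (\<forall>v\<in>S. Ck_on m S D (\<lambda>x. ddir f x v))"

definition smooth_map_on :: "'a::euclidean_space set \<Rightarrow> 'a set \<Rightarrow> ('a \<Rightarrow> 'b::real_normed_vector) \<Rightarrow> bool" where
  "smooth_map_on S D f \<longleftrightarrow> (\<forall>m. Ck_on m S D f)"

definition local_param ::
  "'a::euclidean_space set \<Rightarrow> 'a set \<Rightarrow> 'a set \<Rightarrow> ('a \<Rightarrow> 'a) \<Rightarrow> bool" where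
  "local_param N S D \<psi> \<longleftrightarrow>
     subspace S \<and> openin (top_of_set S) D \<and> smooth_map_on S D \<psi> \<and>
     (\<forall>x\<in>D. \<forall>v\<in>S. ddir \<psi> x v = 0 \<longrightarrow> v = 0) \<and>
     openin (top_of_set N) (\<psi> ` D) \<and> (\<exists>\<phi>. homeomorphism D (\<psi> ` D) \<psi> \<phi>)"

definition submanifold :: "nat \<Rightarrow> 'a::euclidean_space set \<Rightarrow> bool" where
  "submanifold d N \<longleftrightarrow> (\<forall>x\<in>N. \<exists>S D \<psi>. local_param N S D \<psi> \<and> dim S = d \<and> x \<in> \<psi> ` D)"

text \<open>Velocities of smooth curves. This also gives the tangent spaces of the (possibly only
  immersed) leaves of a foliation, because a smooth curve with values in a leaf stays locally in
  a plaque.\<close>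

definition tangent_space :: "'a::euclidean_space set \<Rightarrow> 'a \<Rightarrow> 'a set" where
  "tangent_space N x =
     {vector_derivative c (at 0) | (c :: real \<Rightarrow> 'a) e.
        e > 0 \<and> smooth_map_on UNIV {-e<..<e} c \<and> c ` {-e<..<e} \<subseteq> N \<and> c 0 = x}"

definition complex_submanifold :: "('a::euclidean_space \<Rightarrow> 'a \<Rightarrow> 'a) \<Rightarrow> 'a set \<Rightarrow> bool" where
  "complex_submanifold J N \<longleftrightarrow>
     (\<exists>d. submanifold d N) \<and> (\<forall>x\<in>N. J x ` tangent_space N x \<subseteq> tangent_space N x)"


section \<open>Geodesics\<close>

definition coord_metric ::
  "('a::euclidean_space \<Rightarrow> 'a \<Rightarrow> 'a \<Rightarrow> real) \<Rightarrow> ('a \<Rightarrow> 'a) \<Rightarrow> 'a \<Rightarrow> 'a \<Rightarrow> 'a \<Rightarrow> real" where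
  "coord_metric g \<psi> u a b = g (\<psi> u) (ddir \<psi> u a) (ddir \<psi> u b)"

text \<open>Christoffel symbols of the first kind, as a trilinear form:
  \<open>g (\<nabla>\<^sub>a b) e\<close> for constant coordinate fields \<open>a, b, e\<close>.\<close>

definition christoffel ::
  "('a::euclidean_space \<Rightarrow> 'a \<Rightarrow> 'a \<Rightarrow> real) \<Rightarrow> ('a \<Rightarrow> 'a) \<Rightarrow> 'a \<Rightarrow> 'a \<Rightarrow> 'a \<Rightarrow> 'a \<Rightarrow> real" where
  "christoffel g \<psi> u a b e =
     (ddir (\<lambda>y. coord_metric g \<psi> y b e) u a + ddir (\<lambda>y. coord_metric g \<psi> y a e) u b
      - ddir (\<lambda>y. coord_metric g \<psi> y a b) u e) / 2"

text \<open>The geodesic equation of the Levi-Civita connection of \<open>(N, g)\<close>, tested against all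
  coordinate directions \<open>e\<close> (index lowered, so no inverse of the metric matrix is needed).\<close>

definition geodesic ::
  "'a::euclidean_space set \<Rightarrow> ('a \<Rightarrow> 'a \<Rightarrow> 'a \<Rightarrow> real) \<Rightarrow> real set \<Rightarrow> (real \<Rightarrow> 'a) \<Rightarrow> bool" where
  "geodesic N g I c \<longleftrightarrow>
     open I \<and> is_interval I \<and> smooth_map_on UNIV I c \<and> c ` I \<subseteq> N \<and>
     (\<forall>S D \<psi> I' \<gamma>. local_param N S D \<psi> \<and> open I' \<and> I' \<subseteq> I \<and>
        (\<forall>t\<in>I'. \<gamma> t \<in> D \<and> \<psi> (\<gamma> t) = c t) \<longrightarrow>
        (\<forall>t\<in>I'. \<forall>e\<in>S.
           (let \<gamma>' = (\<lambda>s. vector_derivative \<gamma> (at s)); \<gamma>'' = (\<lambda>s. vector_derivative \<gamma>' (at s)) in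
            coord_metric g \<psi> (\<gamma> t) (\<gamma>'' t) e + christoffel g \<psi> (\<gamma> t) (\<gamma>' t) (\<gamma>' t) e = 0)))"

text \<open>Every geodesic of \<open>N\<close> that is tangent to \<open>L\<close> at some time stays in \<open>L\<close> near that time.\<close>

definition totally_geodesic ::
  "'a::euclidean_space set \<Rightarrow> ('a \<Rightarrow> 'a \<Rightarrow> 'a \<Rightarrow> real) \<Rightarrow> 'a set \<Rightarrow> bool" where
  "totally_geodesic N g L \<longleftrightarrow>
     (\<forall>I c t0. geodesic N g I c \<and> t0 \<in> I \<and> c t0 \<in> L \<and>
        vector_derivative c (at t0) \<in> tangent_space L (c t0) \<longrightarrow>
        (\<exists>e>0. \<forall>t\<in>I. \<bar>t - t0\<bar> < e \<longrightarrow> c t \<in> L))"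


section \<open>Foliations\<close>

text \<open>A foliation is given by its set of leaves. In a foliated parametrization the connected
  components of the intersections of leaves with the parametrized open set are the plaques, i.e.
  the images of the slices of \<open>D\<close> parallel to \<open>A\<close>. As leaves meet a chart in such plaques only,
  a path within a leaf is continuous for the leaf topology.\<close>

definition foliated_param ::
  "'a::euclidean_space set \<Rightarrow> 'a set set \<Rightarrow> 'a set \<Rightarrow> 'a set \<Rightarrow> 'a set \<Rightarrow> ('a \<Rightarrow> 'a) \<Rightarrow> bool" where
  "foliated_param N \<L> A S D \<psi> \<longleftrightarrow>
     local_param N S D \<psi> \<and> subspace A \<and> A \<subseteq> S \<and>
     (\<forall>L\<in>\<L>. \<forall>u\<in>D. \<psi> u \<in> L \<longrightarrow>
        connected_component_set (L \<inter> \<psi> ` D) (\<psi> u) = \<psi> ` {u'\<in>D. u' - u \<in> A})"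

definition foliation :: "'a::euclidean_space set \<Rightarrow> 'a set set \<Rightarrow> bool" where
  "foliation N \<L> \<longleftrightarrow>
     partition_on N \<L> \<and> (\<forall>L\<in>\<L>. path_connected L) \<and>
     (\<exists>p. \<forall>x\<in>N. \<exists>A S D \<psi>. foliated_param N \<L> A S D \<psi> \<and> dim A = p \<and> x \<in> \<psi> ` D)"

definition leaf :: "'a set set \<Rightarrow> 'a \<Rightarrow> 'a set" where
  "leaf \<L> x = (THE L. L \<in> \<L> \<and> x \<in> L)"

definition leaf_tangent :: "'a::euclidean_space set set \<Rightarrow> 'a \<Rightarrow> 'a set" where
  "leaf_tangent \<L> x = tangent_space (leaf \<L> x) x"

definition leaf_normal ::
  "'a::euclidean_space set \<Rightarrow> ('a \<Rightarrow> 'a \<Rightarrow> 'a \<Rightarrow> real) \<Rightarrow> 'a set set \<Rightarrow> 'a \<Rightarrow> 'a set" where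
  "leaf_normal N g \<L> x = {v \<in> tangent_space N x. \<forall>u\<in>leaf_tangent \<L> x. g x u v = 0}"

text \<open>The linear leaf holonomy along paths in leaves, acting on the normal bundle of the foliation
  (represented by the orthogonal complement of the leaf tangent spaces). Within a foliated chart,
  holonomy along a plaque identifies normal vectors with the same transverse component, that is,
  with equal classes modulo \<open>A\<close>; holonomy along an arbitrary path in a leaf is a composition of such
  steps along a chain of plaques.\<close>

inductive leaf_holonomy ::
  "'a::euclidean_space set \<Rightarrow> ('a \<Rightarrow> 'a \<Rightarrow> 'a \<Rightarrow> real) \<Rightarrow> 'a set set \<Rightarrow> 'a \<Rightarrow> 'a \<Rightarrow> 'a \<Rightarrow> 'a \<Rightarrow> bool"
  for N g \<L> where
  plaque: "\<lbrakk>foliated_param N \<L> A S D \<psi>; u \<in> D; u' \<in> D; u' - u \<in> A; v \<in> S; v' \<in> S; v' - v \<in> A;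
    ddir \<psi> u v \<in> leaf_normal N g \<L> (\<psi> u); ddir \<psi> u' v' \<in> leaf_normal N g \<L> (\<psi> u')\<rbrakk>
    \<Longrightarrow> leaf_holonomy N g \<L> (\<psi> u) (ddir \<psi> u v) (\<psi> u') (ddir \<psi> u' v')"
| trans: "\<lbrakk>leaf_holonomy N g \<L> x X y Y; leaf_holonomy N g \<L> y Y z Z\<rbrakk>
    \<Longrightarrow> leaf_holonomy N g \<L> x X z Z"

text \<open>Holonomy maps being linear, invariance of the metric amounts to invariance of squared lengths.\<close>

definition riemannian_foliation ::
  "'a::euclidean_space set \<Rightarrow> ('a \<Rightarrow> 'a \<Rightarrow> 'a \<Rightarrow> real) \<Rightarrow> 'a set set \<Rightarrow> bool" where
  "riemannian_foliation N g \<L> \<longleftrightarrow>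
     foliation N \<L> \<and> (\<forall>x X y Y. leaf_holonomy N g \<L> x X y Y \<longrightarrow> g x X X = g y Y Y)"

definition totally_geodesic_foliation ::
  "'a::euclidean_space set \<Rightarrow> ('a \<Rightarrow> 'a \<Rightarrow> 'a \<Rightarrow> real) \<Rightarrow> 'a set set \<Rightarrow> bool" where
  "totally_geodesic_foliation N g \<L> \<longleftrightarrow> foliation N \<L> \<and> (\<forall>L\<in>\<L>. totally_geodesic N g L)"

definition kahler_form ::
  "('a \<Rightarrow> 'a \<Rightarrow> 'a \<Rightarrow> real) \<Rightarrow> ('a \<Rightarrow> 'a \<Rightarrow> 'a) \<Rightarrow> 'a \<Rightarrow> 'a \<Rightarrow> 'a \<Rightarrow> real" where
  "kahler_form g J x u v = g x (J x u) v"

definition lagrangian ::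
  "'a::euclidean_space set \<Rightarrow> ('a \<Rightarrow> 'a \<Rightarrow> 'a \<Rightarrow> real) \<Rightarrow> ('a \<Rightarrow> 'a \<Rightarrow> 'a) \<Rightarrow> 'a set \<Rightarrow> bool" where
  "lagrangian N g J L \<longleftrightarrow>
     (\<forall>x\<in>L. 2 * dim (tangent_space L x) = dim (tangent_space N x) \<and>
        (\<forall>u\<in>tangent_space L x. \<forall>v\<in>tangent_space L x. kahler_form g J x u v = 0))"

definition lagrangian_frame ::
  "'a::euclidean_space set \<Rightarrow> ('a \<Rightarrow> 'a \<Rightarrow> 'a \<Rightarrow> real) \<Rightarrow> ('a \<Rightarrow> 'a \<Rightarrow> 'a)
     \<Rightarrow> 'a set set \<Rightarrow> 'a set set \<Rightarrow> bool" where
  "lagrangian_frame N g J \<O> \<F> \<longleftrightarrow>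
     foliation N \<O> \<and> foliation N \<F> \<and>
     (\<forall>L\<in>\<O> \<union> \<F>. lagrangian N g J L) \<and>
     (\<forall>L1\<in>\<O>. \<forall>L2\<in>\<F>. \<forall>x\<in>L1 \<inter> L2.
        \<forall>u\<in>tangent_space L1 x. \<forall>v\<in>tangent_space L2 x. g x u v = 0) \<and>
     riemannian_foliation N g \<O> \<and> totally_geodesic_foliation N g \<F>"


section \<open>Complex projective space with its Fubini--Study structure\<close>

text \<open>The point \<open>[w]\<close> of projective space, i.e. the line spanned by \<open>w\<close>, is represented by the
  orthogonal projector onto that line; this realizes projective space as a compact submanifold of
  the Euclidean space of complex matrices. The Fubini--Study structure is the one that makes the
  differential of \<open>w \<mapsto> [w]\<close> complex linear and has the potential \<open>log |w|\<^sup>2\<close> in homogeneous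
  coordinates; it is not defined through the Euclidean structure of the space of matrices.\<close>

definition proj :: "complex^'m \<Rightarrow> complex^'m^'m" where
  "proj w = (\<chi> a b. w $ a * cnj (w $ b) / of_real ((norm w)\<^sup>2))"

definition dproj :: "complex^'m \<Rightarrow> complex^'m \<Rightarrow> complex^'m^'m" where
  "dproj w = frechet_derivative proj (at w)"

definition herm :: "complex^'m \<Rightarrow> complex^'m \<Rightarrow> complex" where
  "herm u v = (\<Sum>a\<in>UNIV. u $ a * cnj (v $ a))"

definition fs_lift :: "complex^'m \<Rightarrow> complex^'m \<Rightarrow> complex^'m \<Rightarrow> real" where
  "fs_lift w u v = Re (herm u v * of_real ((norm w)\<^sup>2) - herm u w * herm w v) / (norm w) ^ 4"

definition fs_metric :: "complex^'m^'m \<Rightarrow> complex^'m^'m \<Rightarrow> complex^'m^'m \<Rightarrow> real" where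
  "fs_metric P X Y =
     (THE r. \<exists>w u v. w \<noteq> 0 \<and> proj w = P \<and> dproj w u = X \<and> dproj w v = Y \<and> r = fs_lift w u v)"

definition fs_J :: "complex^'m^'m \<Rightarrow> complex^'m^'m \<Rightarrow> complex^'m^'m" where
  "fs_J P X = (THE Y. \<exists>w u. w \<noteq> 0 \<and> proj w = P \<and> dproj w u = X \<and> Y = dproj w (\<i> *s u))"

definition psl_class :: "complex^'m^'m \<Rightarrow> (complex^'m^'m) set" where
  "psl_class A = {mat c ** A | c. cmod c = 1 \<and> det (mat c :: complex^'m^'m) = 1}"

definition psl_act :: "(complex^'m^'m) set \<Rightarrow> complex^'m^'m \<Rightarrow> complex^'m^'m" where
  "psl_act X P = (THE Q. \<exists>A\<in>X. \<exists>w. w \<noteq> 0 \<and> proj w = P \<and> proj (A *v w) = Q)"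

definition orbit :: "(complex^'m^'m) set set \<Rightarrow> complex^'m^'m \<Rightarrow> (complex^'m^'m) set" where
  "orbit G P = (\<lambda>X. psl_act X P) ` G"


subsection \<open>Well-definedness\<close>

text \<open>The main points are \<open>proj_eq_iff\<close>, \<open>fs_metric_dproj\<close>, \<open>fs_J_dproj\<close> and \<open>psl_act_class\<close>: the
  descriptions above do not depend on the choice of homogeneous coordinates and lifts.\<close>

lemma has_derivative_vecI:
  fixes f :: "'a::real_normed_vector \<Rightarrow> 'b::real_normed_vector^'n"
  assumes "\<And>i. ((\<lambda>x. f x $ i) has_derivative (\<lambda>h. f' h $ i)) (at x within s)"
  shows "(f has_derivative f') (at x within s)"
proof -
  have bl: "bounded_linear (\<lambda>h. f' h $ i)" for i using assms has_derivative_bounded_linear by blast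
  have nb: "norm (f' h) \<le> norm h * (\<Sum>i\<in>UNIV. onorm (\<lambda>h. f' h $ i))" for h
  proof -
    have "norm (f' h) \<le> (\<Sum>i\<in>UNIV. norm (f' h $ i))" by (simp add: norm_vec_def L2_set_le_sum)
    also have "\<dots> \<le> (\<Sum>i\<in>UNIV. onorm (\<lambda>h. f' h $ i) * norm h)"
      by (intro sum_mono onorm[OF bl])
    finally show ?thesis by (simp add: sum_distrib_left mult.commute)
  qed
  have "bounded_linear f'"
    by (rule bounded_linear_intro[OF _ _ nb])
       (simp_all add: vec_eq_iff linear_add[OF bounded_linear.linear[OF bl]] linear_scale[OF bounded_linear.linear[OF bl]])
  then show ?thesis using assms
    by (auto simp: has_derivative_within intro!: vec_tendstoI)
qed

lemma proj_derivative:
  fixes w :: "complex^'m"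
  assumes "w \<noteq> 0"
  shows "(proj has_derivative (\<lambda>u. \<chi> a b. (u$a * cnj (w$b) + w$a * cnj (u$b)) / of_real (w \<bullet> w)
     - of_real (2 * (w \<bullet> u)) * (w$a * cnj (w$b)) / of_real ((w \<bullet> w)^2))) (at w)"
proof -
  have eq: "proj = (\<lambda>w::complex^'m. \<chi> a b. w$a * cnj (w$b) * complex_of_real (inverse (w \<bullet> w)))"
    by (simp add: proj_def fun_eq_iff dot_square_norm divide_inverse)
  have ww: "w \<bullet> w \<noteq> 0" using assms by simp
  show ?thesis unfolding eq
    apply (intro has_derivative_vecI)
    apply (simp del: of_real_inverse)
    apply (rule has_derivative_eq_rhs)
     apply (rule has_derivative_mult)
      apply (rule has_derivative_mult)
       apply (rule bounded_linear.has_derivative[OF bounded_linear_vec_nth has_derivative_ident])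
      apply (rule bounded_linear.has_derivative[OF bounded_linear_cnj])
      apply (rule bounded_linear.has_derivative[OF bounded_linear_vec_nth has_derivative_ident])
     apply (rule bounded_linear.has_derivative[OF bounded_linear_of_real])
     apply (rule Deriv.has_derivative_inverse, rule ww)
     apply (rule has_derivative_inner[OF has_derivative_ident has_derivative_ident])
    using ww by (simp add: fun_eq_iff field_simps power2_eq_square inner_commute)
qed

lemma dproj_eq: "w \<noteq> 0 \<Longrightarrow> dproj w u = (\<chi> a b. (u$a * cnj (w$b) + w$a * cnj (u$b)) / of_real (w \<bullet> w)
     - of_real (2 * (w \<bullet> u)) * (w$a * cnj (w$b)) / of_real ((w \<bullet> w)^2))"
  unfolding dproj_def by (subst frechet_derivative_at[OF proj_derivative, symmetric]) (assumption, rule refl)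

lemma herm_self: "herm w w = of_real (w \<bullet> w)"
  by (simp add: herm_def inner_vec_def complex_norm_square[symmetric] dot_square_norm)
lemma herm_Re: "2 * complex_of_real (w \<bullet> u) = herm u w + cnj (herm u w)"
  unfolding herm_def inner_vec_def
  by (simp add: complex_eq_iff sum_distrib_left inner_complex_def mult.commute flip: sum.distrib)
lemma herm_cnj: "cnj (herm u w) = herm w u" by (simp add: herm_def mult.commute)

lemma dproj_lift: assumes "w \<noteq> 0"
  shows "dproj w u *v w = u - (herm u w / of_real (w \<bullet> w)) *s w"
proof -
  have ww: "complex_of_real (w \<bullet> w) \<noteq> 0" using assms by simp
  have "(dproj w u *v w) $ a = u $ a - (herm u w / of_real (w \<bullet> w)) * w $ a" for a
  proof -
    let ?N = "complex_of_real (w \<bullet> w)"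
    have "(dproj w u *v w) $ a = (\<Sum>b\<in>UNIV. u$a / ?N * (w$b * cnj (w$b)) + w$a / ?N * (w$b * cnj (u$b))
       - of_real (2 * (w \<bullet> u)) * w$a / ?N^2 * (w$b * cnj (w$b)))"
      unfolding dproj_eq[OF assms] matrix_vector_mult_def using ww 
      by (simp add: algebra_simps add_divide_distrib diff_divide_distrib)
    also have "\<dots> = u$a / ?N * herm w w + w$a / ?N * herm w u - of_real (2 * (w \<bullet> u)) * w$a / ?N^2 * herm w w"
      by (simp add: herm_def sum.distrib sum_subtractf sum_distrib_left)
    also have "\<dots> = u $ a - (herm u w / ?N) * w $ a"
      using ww herm_Re[of w u] herm_cnj[of u w] by (simp add: herm_self field_simps power2_eq_square)
    finally show ?thesis .
  qed
  then show ?thesis by (simp add: vec_eq_iff)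
qed

lemma herm_lin: "herm (u - c *s w) v = herm u v - c * herm w v" "herm u (v - c *s w) = herm u v - cnj c * herm u w"
  "herm (c *s u) v = c * herm u v"  "herm u (c *s v) = cnj c * herm u v"
  by (simp_all add: herm_def sum_subtractf sum_distrib_left algebra_simps)

lemma norm_smult: "(norm (c *s (w::complex^'m)))\<^sup>2 = (cmod c)\<^sup>2 * (norm w)\<^sup>2"
  by (simp add: norm_vec_def L2_set_def norm_mult power_mult_distrib sum_nonneg flip: sum_distrib_left)

lemma fs_lift_eq: assumes "w \<noteq> 0"
  shows "fs_lift w u v = Re (herm (dproj w u *v w) (dproj w v *v w)) / (norm w)\<^sup>2"
proof -
  have ww: "complex_of_real (w \<bullet> w) \<noteq> 0" using assms by simp
  have "herm (dproj w u *v w) (dproj w v *v w) = (herm u v * of_real (w \<bullet> w) - herm u w * herm w v) / of_real (w \<bullet> w)"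
    unfolding dproj_lift[OF assms] using ww by (simp add: herm_lin herm_self field_simps herm_cnj)
  then show ?thesis
    by (simp add: fs_lift_def dot_square_norm power4_eq_xxxx power2_eq_square Re_divide_of_real flip: of_real_mult)
qed

lemma proj_mv: "w \<noteq> 0 \<Longrightarrow> proj w *v x = (herm x w / of_real (w \<bullet> w)) *s w"
  by (simp add: vec_eq_iff proj_def matrix_vector_mult_def herm_def dot_square_norm sum_divide_distrib sum_distrib_left algebra_simps)

lemma proj_eq_iff:
  assumes "w \<noteq> 0" "w' \<noteq> 0"
  shows "proj w = proj w' \<longleftrightarrow> (\<exists>c. c \<noteq> 0 \<and> w' = c *s w)"
proof
  assume "proj w = proj w'"
  then have "proj w *v w' = w'" using assms by (simp add: proj_mv herm_self)
  then have "w' = (herm w' w / of_real (w \<bullet> w)) *s w" using assms by (simp add: proj_mv)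
  then show "\<exists>c. c \<noteq> 0 \<and> w' = c *s w" using assms by (metis vector_smult_lzero)
next
  assume "\<exists>c. c \<noteq> 0 \<and> w' = c *s w"
  then obtain c where c: "c \<noteq> 0" "w' = c *s w" by auto
  have n: "complex_of_real ((norm w')\<^sup>2) = c * cnj c * of_real ((norm w)\<^sup>2)"
    unfolding c(2) norm_smult of_real_mult complex_norm_square ..
  then show "proj w = proj w'" unfolding proj_def n using c by (simp add: vec_eq_iff)
qed

lemma dproj_scale: assumes "w \<noteq> 0" "c \<noteq> 0" shows "dproj (c *s w) (c *s u) = dproj w u"
proof -
  have n: "complex_of_real ((c *s w) \<bullet> (c *s w)) = c * cnj c * of_real (w \<bullet> w)"
    by (simp flip: herm_self add: herm_lin)
  have i: "2 * complex_of_real ((c *s w) \<bullet> (c *s u)) = c * cnj c * (2 * of_real (w \<bullet> u))"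
    by (simp add: herm_Re herm_lin algebra_simps)
  have cw: "c *s w \<noteq> 0" using assms by (simp add: vec_eq_iff)
  show ?thesis unfolding dproj_eq[OF assms(1)] dproj_eq[OF cw] of_real_mult of_real_power of_real_numeral n i
    using assms by (simp add: vec_eq_iff field_simps power2_eq_square)
qed

lemma mv_scale: "A *v (c *s w) = c *s (A *v (w::complex^'m))"
  by (simp add: vec_eq_iff matrix_vector_mult_def sum_distrib_left algebra_simps)

lemma fs_metric_dproj:
  assumes "w \<noteq> 0"
  shows "fs_metric (proj w) (dproj w u) (dproj w v) = fs_lift w u v"
  unfolding fs_metric_def
proof (rule the_equality, use assms in blast)
  fix r assume "\<exists>w' u' v'. w' \<noteq> 0 \<and> proj w' = proj w \<and> dproj w' u' = dproj w u \<and> dproj w' v' = dproj w v \<and> r = fs_lift w' u' v'"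
  then obtain w' u' v' where h: "w' \<noteq> 0" "proj w' = proj w" "dproj w' u' = dproj w u" "dproj w' v' = dproj w v" "r = fs_lift w' u' v'" by blast
  obtain c where c: "c \<noteq> 0" "w' = c *s w" using proj_eq_iff[OF assms h(1)] h(2) by auto
  have n: "(norm w')\<^sup>2 = (cmod c)\<^sup>2 * (norm w)\<^sup>2"
    unfolding c(2) norm_smult ..
  have e: "herm (c *s x) (c *s y) = of_real ((cmod c)\<^sup>2) * herm x y" for x y :: "complex^'a"
    by (simp add: herm_lin complex_norm_square mult.assoc del: of_real_power)
  show "r = fs_lift w u v"
    unfolding h(5) fs_lift_eq[OF h(1)] fs_lift_eq[OF assms] h n unfolding c mv_scale e
    using c by (simp del: of_real_power)
qed

lemma fs_J_dproj:
  assumes "w \<noteq> 0"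
  shows "fs_J (proj w) (dproj w u) = dproj w (\<i> *s u)"
  unfolding fs_J_def
proof (rule the_equality, use assms in blast)
  fix Y assume "\<exists>w' u'. w' \<noteq> 0 \<and> proj w' = proj w \<and> dproj w' u' = dproj w u \<and> Y = dproj w' (\<i> *s u')"
  then obtain w' u' where h: "w' \<noteq> 0" "proj w' = proj w" "dproj w' u' = dproj w u" "Y = dproj w' (\<i> *s u')" by blast
  obtain c where c: "c \<noteq> 0" "w' = c *s w" using proj_eq_iff[OF assms h(1)] h(2) by auto
  define u'' where "u'' = (1/c) *s u'"
  have u': "u' = c *s u''" using c by (simp add: u''_def vec_eq_iff)
  have d: "dproj w u'' = dproj w u" using h(3) unfolding c(2) u' dproj_scale[OF assms c(1)] .
  have Y: "Y = dproj w (\<i> *s u'')" 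
    using dproj_scale[OF assms c(1), of "\<i> *s u''"] by (simp add: h(4) c(2) u' mult.commute)
  define d0 where "d0 = (herm (u'' - u) w / of_real (w \<bullet> w))"
  have "dproj w u'' *v w = dproj w u *v w" using d by simp
  then have "u'' = u + d0 *s w" unfolding dproj_lift[OF assms] d0_def
    by (simp add: herm_def vec_eq_iff algebra_simps sum_subtractf diff_divide_distrib)
  then have 1: "\<i> *s u'' = \<i> *s u + (\<i> * d0) *s w" by (simp add: vec_eq_iff algebra_simps)
  have ww: "complex_of_real (w \<bullet> w) \<noteq> 0" using assms by simp
  have ker: "dproj w (e *s w) = 0" for e
  proof -
    have r: "complex_of_real (2 * (w \<bullet> (e *s w))) = (e + cnj e) * of_real (w \<bullet> w)"
      using herm_Re[of w "e *s w"] by (simp add: herm_lin herm_self algebra_simps)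
    show ?thesis unfolding dproj_eq[OF assms] r using ww by (simp add: vec_eq_iff field_simps power2_eq_square)
  qed
  have "linear (dproj w)" 
    unfolding dproj_def by (subst frechet_derivative_at[OF proj_derivative[OF assms], symmetric]) (rule has_derivative_linear[OF proj_derivative[OF assms]])
  then show "Y = dproj w (\<i> *s u)" unfolding Y 1 by (simp add: linear_add ker)
qed

lemma psl_act_class:
  assumes "w \<noteq> 0" and A: "det A \<noteq> 0"
  shows "psl_act (psl_class A) (proj w) = proj (A *v w)"
  unfolding psl_act_def
proof (rule the_equality)
  have "A \<in> psl_class A" by (auto simp: psl_class_def intro!: exI[of _ 1])
  then show "\<exists>B\<in>psl_class A. \<exists>v. v \<noteq> 0 \<and> proj v = proj w \<and> proj (B *v v) = proj (A *v w)"
    using assms by blast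
next
  fix Q assume "\<exists>B\<in>psl_class A. \<exists>v. v \<noteq> 0 \<and> proj v = proj w \<and> proj (B *v v) = Q"
  then obtain b v where h: "cmod b = 1" "v \<noteq> 0" "proj v = proj w" "proj ((mat b ** A) *v v) = Q"
    by (auto simp: psl_class_def)
  obtain c where c: "c \<noteq> 0" "v = c *s w" using proj_eq_iff[OF assms(1) h(2)] h(3) by auto
  have b: "b \<noteq> 0" using h(1) by auto
  have "mat b *v x = b *s x" for x :: "complex^'a"
    by (simp add: vec_eq_iff matrix_vector_mult_def mat_def if_distrib[of "\<lambda>x. x * _"] cong: if_cong)
  then have e: "(mat b ** A) *v v = (b * c) *s (A *v w)"
    by (simp add: c mv_scale vec.scale_scale flip: matrix_vector_mul_assoc)
  obtain B where B: "B ** A = mat 1" using A invertible_det_nz unfolding invertible_def by blast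
  have nz: "A *v w \<noteq> 0"
  proof
    assume "A *v w = 0"
    then have "B *v (A *v w) = 0" by simp
    then show False using assms(1) B by (simp add: matrix_vector_mul_assoc)
  qed
  then have nz2: "(b * c) *s (A *v w) \<noteq> 0" using b c by (simp add: vec.scale_eq_0_iff)
  have "proj (A *v w) = proj ((b * c) *s (A *v w))"
    unfolding proj_eq_iff[OF nz nz2] by (rule exI[of _ "b * c"]) (use b c in simp)
  then show "Q = proj (A *v w)" using h(4) e c(2) by simp
qed


section \<open>Blocks, groups and strata attached to a partition\<close>

definition partition_of :: "nat \<Rightarrow> nat list \<Rightarrow> bool" where
  "partition_of n k \<longleftrightarrow> sorted k \<and> (\<forall>x\<in>set k. 0 < x) \<and> sum_list k = n"

text \<open>\<open>idx\<close> labels the coordinates of \<open>complex^'m\<close>: \<open>idx i = (j, r)\<close> means that \<open>w $ i\<close> is the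
  \<open>r\<close>-th entry (counted from 1) of the block \<open>w\<^sub>(\<^sub>j\<^sub>)\<close>. Block \<open>0\<close> has size 1 and block \<open>j \<ge> 1\<close> has
  size \<open>k ! (j - 1)\<close>, list positions being counted from 0.\<close>

definition block_labelling :: "nat list \<Rightarrow> ('m::finite \<Rightarrow> nat \<times> nat) \<Rightarrow> bool" where
  "block_labelling k idx \<longleftrightarrow>
     bij_betw idx UNIV (SIGMA j:{0..length k}. {1..(if j = 0 then 1 else k ! (j - 1))})"

definition block :: "('m \<Rightarrow> nat \<times> nat) \<Rightarrow> nat \<Rightarrow> 'm set" where
  "block idx j = {i. fst (idx i) = j}"

definition block_norm :: "('m::finite \<Rightarrow> nat \<times> nat) \<Rightarrow> complex^'m \<Rightarrow> nat \<Rightarrow> real" where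
  "block_norm idx w j = sqrt (\<Sum>i\<in>block idx j. (cmod (w $ i))\<^sup>2)"

definition block_zero :: "('m::finite \<Rightarrow> nat \<times> nat) \<Rightarrow> complex^'m \<Rightarrow> nat \<Rightarrow> bool" where
  "block_zero idx w j \<longleftrightarrow> (\<forall>i\<in>block idx j. w $ i = 0)"

definition block_diag :: "('m::finite \<Rightarrow> nat \<times> nat) \<Rightarrow> (nat \<Rightarrow> complex) \<Rightarrow> complex^'m^'m" where
  "block_diag idx z = (\<chi> a b. if a = b then z (fst (idx a)) else 0)"

definition stratum :: "nat list \<Rightarrow> ('m::finite \<Rightarrow> nat \<times> nat) \<Rightarrow> nat \<Rightarrow> (complex^'m^'m) set" where
  "stratum k idx j =
     {proj w | w. (\<forall>i\<in>{j..length k}. \<not> block_zero idx w i) \<and> (\<forall>i<j. block_zero idx w i)}"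

text \<open>For \<open>j = 0\<close> (as for \<open>j = 1\<close>) the condition on the indices \<open>1 \<le> i < j\<close> is void.\<close>

definition G_group :: "nat list \<Rightarrow> ('m::finite \<Rightarrow> nat \<times> nat) \<Rightarrow> nat \<Rightarrow> (complex^'m^'m) set set" where
  "G_group k idx j =
     {psl_class (block_diag idx z) | z :: nat \<Rightarrow> complex.
        (\<forall>i\<le>length k. z i \<noteq> 0) \<and> (\<forall>i. 1 \<le> i \<and> i < j \<longrightarrow> z i = 1) \<and>
        z 0 * (\<Prod>i\<in>{1..length k}. z i ^ (k ! (i - 1))) = 1}"

definition torus :: "nat list \<Rightarrow> ('m::finite \<Rightarrow> nat \<times> nat) \<Rightarrow> (complex^'m^'m) set set" where
  "torus k idx =
     {psl_class (block_diag idx (\<lambda>i. if i = 0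
        then (\<Prod>r\<in>{1..length k}. cnj (t r) ^ (k ! (r - 1))) else t i)) | t :: nat \<Rightarrow> complex.
        \<forall>i\<in>{1..length k}. cmod (t i) = 1}"

definition T_group :: "nat list \<Rightarrow> ('m::finite \<Rightarrow> nat \<times> nat) \<Rightarrow> nat \<Rightarrow> (complex^'m^'m) set set" where
  "T_group k idx j = G_group k idx j \<inter> torus k idx"


section \<open>Symbols\<close>

text \<open>Symbols are partial functions on projective space. The argument of \<open>a\<close> is the list of the
  block norms \<open>|w\<^sub>(\<^sub>0\<^sub>)|, \<dots>, |w\<^sub>(\<^sub>l\<^sub>)|\<close>.\<close>

definition symbols ::
  "nat list \<Rightarrow> nat list \<Rightarrow> ('m::finite \<Rightarrow> nat \<times> nat) \<Rightarrow> (complex^'m^'m \<Rightarrow> complex option) set" where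
  "symbols k h idx =
     {\<phi>. dom \<phi> \<subseteq> proj ` (- {0}) \<and>
       (\<exists>(a :: real list \<Rightarrow> complex) (p :: 'm \<Rightarrow> nat) (q :: 'm \<Rightarrow> nat).
         (\<forall>r c. length r = Suc (length k) \<and> (\<forall>x\<in>set r. 0 \<le> x) \<and> c > 0 \<longrightarrow>
            a (map ((*) c) r) = a r) \<and>
         (\<Sum>i\<in>UNIV. p i * q i) = 0 \<and>
         (\<forall>j\<le>length k. (\<Sum>i\<in>block idx j. p i) = (\<Sum>i\<in>block idx j. q i)) \<and>
         (\<forall>i j r. idx i = (j, r) \<and> 1 \<le> j \<longrightarrow>
            (h ! (j - 1) < r \<longrightarrow> p i = 0) \<and> (r \<le> h ! (j - 1) \<longrightarrow> q i = 0)) \<and>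
         (\<forall>w. w \<noteq> 0 \<longrightarrow> \<phi> (proj w) =
            (if \<forall>j\<le>length k. (\<exists>i\<in>block idx j. p i \<noteq> 0 \<or> q i \<noteq> 0) \<longrightarrow> \<not> block_zero idx w j
             then Some (a (map (block_norm idx w) [0..<Suc (length k)]) *
               (\<Prod>j\<le>length k. (\<Prod>i\<in>block idx j. (w $ i / of_real (block_norm idx w j)) ^ p i) *
                              (\<Prod>i\<in>block idx j. (cnj (w $ i) / of_real (block_norm idx w j)) ^ q i)))
             else None)))}"

definition constant_on_leaf :: "('b \<Rightarrow> complex option) \<Rightarrow> 'b set \<Rightarrow> bool" where
  "constant_on_leaf \<phi> L \<longleftrightarrow> (\<forall>x\<in>L \<inter> dom \<phi>. \<forall>y\<in>L \<inter> dom \<phi>. \<phi> x = \<phi> y)"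

end

theory Submission
  imports Defs
begin

text \<open>A \<open>G\<^sub>j\<close>-orbit through \<open>[w]\<close> is the image of \<open>u \<mapsto> [exp(u) w]\<close>, where \<open>u\<close> ranges over the
  block-constant diagonal matrices that vanish on the blocks \<open>0, \<dots>, j\<close>; restricted to
  \<open>|Im u| < \<pi>\<close> this is a chart. In it the metric is the real part of the covariance of the
  entries with respect to the weights \<open>|w\<^sub>a|\<^sup>2 / |w|\<^sup>2\<close>, which are unchanged by imaginary translations.
  The torus orbits are the imaginary slices, their normal spaces are the real directions, and the real
  slices integrate these. The squared length of a normal vector can be read off from the diagonal
  entries of the projector and of the vector, which are constant along torus orbits: this gives
  invariance under holonomy. For a geodesic that starts in a real direction, the momenta in the
  imaginary directions are conserved, hence vanish, so the geodesic stays in its real slice.\<close>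

section \<open>Smoothness of the charts\<close>

text \<open>The obstacle is the period 2 pi i of \<open>exp\<close>: a torus orbit closes up, so no
  parametrization of this kind is injective on all imaginary directions. The bound pi on imaginary
  parts is chosen so that two parameters of a chart differ by less than 2 pi, the smallest period;
  then a leaf meets a chart image in one plaque, and \<open>Ln\<close> inverts the chart.
  Normalizing the action on block \<open>j\<close> to the factor 1 uses up the projective scalar. It
  also makes the metric definite: a variance does not see constants, but a constant that vanishes on
  a block of positive weight is 0. Holonomy and the geodesic equation refer to arbitrary charts,
  with opposite effect. Holonomy is a hypothesis about unknown charts, so its invariants must be
  read off in the ambient matrix space, whence the diagonal entries. The geodesic equation may be
  instantiated, so one convenient chart suffices, at the price of proving that the coordinate curve
  is twice differentiable.\<close>

lemma ddir_eq:
  assumes "(f has_derivative f') (at x)"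
  shows "ddir f x v = f' v"
proof -
  have "((\<lambda>t::real. f (x + t *\<^sub>R v)) has_derivative (\<lambda>t. f' (t *\<^sub>R v))) (at 0)"
    by (rule has_derivative_compose[where f = "\<lambda>t. x + t *\<^sub>R v" and g = f])
       (use assms in \<open>auto intro!: derivative_eq_intros\<close>)
  moreover have "f' (t *\<^sub>R v) = t *\<^sub>R f' v" for t
    using assms has_derivative_linear linear_scale by blast
  ultimately show ?thesis
    unfolding ddir_def by (intro vector_derivative_at) (simp add: has_vector_derivative_def)
qed

lemma Ck_on_mono:
  "Ck_on m S D f \<Longrightarrow> S' \<subseteq> S \<Longrightarrow> D' \<subseteq> D \<Longrightarrow> Ck_on m S' D' f"
  by (induction m arbitrary: f) (auto intro: continuous_on_subset differentiable_on_subset)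

text \<open>A class of functions that are differentiable everywhere and that is closed under directional
  derivatives, so that its members satisfy the iterated definition of smoothness.\<close>

inductive elementary :: "('a::real_normed_vector \<Rightarrow> complex) \<Rightarrow> bool" where
  const: "elementary (\<lambda>x. c)"
| linear: "bounded_linear f \<Longrightarrow> elementary f"
| add: "elementary f \<Longrightarrow> elementary g \<Longrightarrow> elementary (\<lambda>x. f x + g x)"
| mult: "elementary f \<Longrightarrow> elementary g \<Longrightarrow> elementary (\<lambda>x. f x * g x)"
| inverse: "elementary f \<Longrightarrow> (\<And>x. f x \<noteq> 0) \<Longrightarrow> elementary (\<lambda>x. inverse (f x))"
| exp: "elementary f \<Longrightarrow> elementary (\<lambda>x. exp (f x))"

lemma elementary_sum:
  "(\<And>i. i \<in> I \<Longrightarrow> elementary (f i)) \<Longrightarrow> elementary (\<lambda>x. \<Sum>i\<in>I. f i x)"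
proof (induction I rule: infinite_finite_induct)
  case (insert i I)
  then have "elementary (\<lambda>x. f i x + (\<Sum>i\<in>I. f i x))" by (intro elementary.add) auto
  then show ?case using insert by simp
qed (simp_all add: elementary.const)

lemma has_derivative_exp_comp:
  fixes f :: "'a::real_normed_vector \<Rightarrow> complex"
  assumes "(f has_derivative f') (at x)"
  shows "((\<lambda>x. exp (f x)) has_derivative (\<lambda>v. exp (f x) * f' v)) (at x)"
proof -
  have e: "(exp has_derivative (\<lambda>v. exp (f x) * v)) (at (f x))"
    using DERIV_exp[of "f x"] unfolding has_field_derivative_def .
  show ?thesis
    using has_derivative_compose[of f f' x UNIV exp "\<lambda>v. exp (f x) * v", OF assms e] .
qed

lemma elementary_derivative:
  assumes "elementary f"
  shows "\<exists>f'. (\<forall>x. (f has_derivative f' x) (at x)) \<and> (\<forall>v. elementary (\<lambda>x. f' x v))"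
  using assms
proof induction
  case (const c)
  show ?case by (intro exI[of _ "\<lambda>x v. 0"]) (auto intro: elementary.const)
next
  case (linear f)
  show ?case
    by (intro exI[of _ "\<lambda>x. f"])
       (auto intro: elementary.const bounded_linear_imp_has_derivative linear)
next
  case (add f g)
  then obtain f' g' where d: "\<And>x. (f has_derivative f' x) (at x)" "\<And>v. elementary (\<lambda>x. f' x v)"
     "\<And>x. (g has_derivative g' x) (at x)" "\<And>v. elementary (\<lambda>x. g' x v)" by blast
  show ?case
    by (intro exI[of _ "\<lambda>x v. f' x v + g' x v"] conjI allI has_derivative_add elementary.add d)
next
  case (mult f g)
  then obtain f' g' where d: "\<And>x. (f has_derivative f' x) (at x)" "\<And>v. elementary (\<lambda>x. f' x v)"
     "\<And>x. (g has_derivative g' x) (at x)" "\<And>v. elementary (\<lambda>x. g' x v)" by blast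
  show ?case
    by (intro exI[of _ "\<lambda>x v. f x * g' x v + f' x v * g x"] conjI allI has_derivative_mult
        elementary.add elementary.mult d mult.hyps)
next
  case (inverse f)
  then obtain f' where d: "\<And>x. (f has_derivative f' x) (at x)" "\<And>v. elementary (\<lambda>x. f' x v)" by blast
  \<comment> \<open>The class has no rule for negation; the constant factor -1 stands in for
    it.\<close>
  have "elementary (\<lambda>x. -1 * (inverse (f x) * f' x v * inverse (f x)))" for v
    by (intro elementary.mult elementary.const elementary.inverse d inverse.hyps)
  then have e: "elementary (\<lambda>x. - (inverse (f x) * f' x v * inverse (f x)))" for v by simp
  show ?case
    by (intro exI[of _ "\<lambda>x v. - (inverse (f x) * f' x v * inverse (f x))"] conjI allI
        Deriv.has_derivative_inverse d e inverse.hyps)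
next
  case (exp f)
  obtain f' where d: "\<And>x. (f has_derivative f' x) (at x)" "\<And>v. elementary (\<lambda>x. f' x v)"
    using exp.IH by metis
  have e: "((\<lambda>x. exp (f x)) has_derivative (\<lambda>v. exp (f x) * f' x v)) (at x)" for x
    by (rule has_derivative_exp_comp[OF d(1)])
  show ?case
    by (intro exI[of _ "\<lambda>x v. exp (f x) * f' x v"] conjI allI e elementary.mult elementary.exp d exp.hyps)
qed

text \<open>The induction on the order runs with all directions and the whole space as domain, where
  derivatives are the ordinary ones; restriction to \<open>S\<close> and \<open>D\<close> comes
  last.\<close>

lemma Ck_on_elementary:
  fixes f :: "'a::euclidean_space \<Rightarrow> complex^'m^'n"
  assumes "\<And>a b. elementary (\<lambda>x. f x $ a $ b)"
  shows "Ck_on m S D f"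
proof -
  have "Ck_on m UNIV UNIV f" using assms
  proof (induction m arbitrary: f)
    case 0
    then have "\<exists>f'. \<forall>x. ((\<lambda>x. f x $ a $ b) has_derivative f' x) (at x)" for a b
      using elementary_derivative by blast
    then have "continuous_on UNIV (\<lambda>x. f x $ a $ b)" for a b
      by (metis continuous_at_imp_continuous_on has_derivative_continuous)
    then have "continuous_on UNIV (\<lambda>x. \<chi> a b. f x $ a $ b)"
      by (intro continuous_on_vec_lambda) auto
    then show ?case by (simp add: vec_lambda_eta)
  next
    case (Suc m)
    obtain f' where f': "\<forall>a b. (\<forall>x. ((\<lambda>x. f x $ a $ b) has_derivative f' a b x) (at x)) \<and>
        (\<forall>v. elementary (\<lambda>x. f' a b x v))"
      using elementary_derivative[OF Suc.prems] by metis
    have d: "(f has_derivative (\<lambda>v. \<chi> a b. f' a b x v)) (at x)" for x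
      by (intro has_derivative_vecI) (use f' in simp)
    have "f differentiable_on UNIV"
      unfolding differentiable_on_def differentiable_def using d has_derivative_at_withinI by blast
    moreover have "Ck_on m UNIV UNIV (\<lambda>x. ddir f x v)" for v
      by (intro Suc.IH) (use f' in \<open>simp add: ddir_eq[OF d]\<close>)
    ultimately show ?case by simp
  qed
  then show ?thesis by (rule Ck_on_mono) auto
qed

text \<open>The parameter is a matrix, of which only the diagonal acts, because
  \<open>local_param\<close> takes its parameters from the same type as the points of the
  manifold.\<close>

definition dexp :: "complex^'m^'m \<Rightarrow> complex^'m \<Rightarrow> complex^'m" where
  "dexp u w = (\<chi> a. exp (u $ a $ a) * w $ a)"

definition dmul :: "complex^'m^'m \<Rightarrow> complex^'m \<Rightarrow> complex^'m" where
  "dmul u w = (\<chi> a. u $ a $ a * w $ a)"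

definition chart :: "complex^'m \<Rightarrow> complex^'m^'m \<Rightarrow> complex^'m^'m" where
  "chart w u = proj (dexp u w)"

lemma dexp_nonzero [simp]: "dexp u w = 0 \<longleftrightarrow> w = 0"
  by (simp add: dexp_def vec_eq_iff)

lemma dexp_0 [simp]: "dexp 0 w = w"
  by (simp add: dexp_def vec_eq_iff)

lemma dexp_add: "dexp (u + v) w = dexp u (dexp v w)"
  by (simp add: dexp_def vec_eq_iff exp_add)

lemma dexp_scale: "dexp u (c *s w) = c *s dexp u w"
  by (simp add: dexp_def vec_eq_iff)

lemma chart_0 [simp]: "chart w 0 = proj w"
  by (simp add: chart_def)

lemma chart_dexp: "chart (dexp u w) v = chart w (v + u)"
  by (simp add: chart_def dexp_add)

text \<open>Diagonal matrices commute with scalars, so a chart depends only on its centre; leaves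
  described by different lifts of a point can thus be compared.\<close>

lemma chart_cong:
  assumes "w \<noteq> 0" "w' \<noteq> 0" "proj w = proj w'"
  shows "chart w u = chart w' u"
proof -
  obtain c where "c \<noteq> 0" "w' = c *s w" using assms proj_eq_iff by blast
  then show ?thesis unfolding chart_def by (subst proj_eq_iff) (use assms in \<open>auto simp: dexp_scale\<close>)
qed

lemma bounded_linear_entry: "bounded_linear (\<lambda>u::complex^'n^'m. u $ a $ b)"
  by (rule bounded_linear_compose[OF bounded_linear_vec_nth bounded_linear_vec_nth])

lemma dexp_has_derivative:
  "((\<lambda>u. dexp u w) has_derivative (\<lambda>v. dmul v (dexp u w))) (at u)"
proof (rule has_derivative_vecI)
  fix a
  have "((\<lambda>u. exp (u $ a $ a) * w $ a) has_derivative (\<lambda>v. exp (u $ a $ a) * v $ a $ a * w $ a)) (at u)"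
    using has_derivative_exp_comp[OF bounded_linear_imp_has_derivative[OF bounded_linear_entry[of a a]]]
    by (rule has_derivative_mult_left)
  then show "((\<lambda>u. dexp u w $ a) has_derivative (\<lambda>v. dmul v (dexp u w) $ a)) (at u)"
    by (simp add: dexp_def dmul_def mult_ac)
qed

lemma dproj_has_derivative: "w \<noteq> 0 \<Longrightarrow> (proj has_derivative dproj w) (at w)"
  unfolding dproj_def using proj_derivative differentiableI frechet_derivative_works by blast

lemma linear_dproj: "w \<noteq> 0 \<Longrightarrow> linear (dproj w)"
  using dproj_has_derivative has_derivative_linear by blast

lemma chart_has_derivative:
  assumes "w \<noteq> 0"
  shows "(chart w has_derivative (\<lambda>v. dproj (dexp u w) (dmul v (dexp u w)))) (at u)"
  unfolding chart_def
  by (rule has_derivative_compose[OF dexp_has_derivative dproj_has_derivative]) (use assms in simp)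

lemma ddir_chart:
  "w \<noteq> 0 \<Longrightarrow> ddir (chart w) u v = dproj (dexp u w) (dmul v (dexp u w))"
  by (rule ddir_eq[OF chart_has_derivative])

text \<open>Conjugation is not an operation of the class, but \<open>cnj\<close> is real linear and
  commutes with \<open>exp\<close>. Hence the squared norm is a sum of products of exponentials of
  linear maps. With \<open>c\<close> the identity this covers charts, with
  \<open>c t = t *\<^sub>R v\<close> the curves that realize tangent vectors.\<close>

lemma elementary_chart:
  fixes c :: "'a::euclidean_space \<Rightarrow> complex^'m^'m"
  assumes "w \<noteq> 0" "bounded_linear c"
  shows "elementary (\<lambda>x. chart w (c x) $ a $ b)"
proof -
  have l: "bounded_linear (\<lambda>x. c x $ d $ d)" for d
    using bounded_linear_compose[OF bounded_linear_entry assms(2)] .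
  have l': "bounded_linear (\<lambda>x. cnj (c x $ d $ d))" for d
    using bounded_linear_compose[OF bounded_linear_cnj l] .
  have n: "complex_of_real ((norm (dexp u w))\<^sup>2) =
      (\<Sum>d\<in>UNIV. exp (u $ d $ d) * w $ d * (exp (cnj (u $ d $ d)) * cnj (w $ d)))" for u
    by (simp only: flip: dot_square_norm herm_self) (simp add: herm_def dexp_def exp_cnj)
  have nz: "(\<Sum>d\<in>UNIV. exp (u $ d $ d) * w $ d * (exp (cnj (u $ d $ d)) * cnj (w $ d))) \<noteq> 0" for u
    unfolding n[symmetric] using assms by simp
  have "elementary (\<lambda>x. exp (c x $ a $ a) * w $ a * (exp (cnj (c x $ b $ b)) * cnj (w $ b)) *
    inverse (\<Sum>d\<in>UNIV. exp (c x $ d $ d) * w $ d * (exp (cnj (c x $ d $ d)) * cnj (w $ d))))"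
    by (intro elementary.mult elementary.inverse elementary_sum elementary.const elementary.exp
        elementary.linear l l' nz)
  then show ?thesis unfolding chart_def proj_def n
    by (simp add: dexp_def exp_cnj divide_inverse)
qed

lemma smooth_chart: "w \<noteq> 0 \<Longrightarrow> smooth_map_on S D (chart w)"
  unfolding smooth_map_on_def
  using Ck_on_elementary[OF elementary_chart[OF _ bounded_linear_ident]] by blast

lemma smooth_chart_line: "w \<noteq> 0 \<Longrightarrow> smooth_map_on S D (\<lambda>t::real. chart w (t *\<^sub>R v))"
  unfolding smooth_map_on_def
  using Ck_on_elementary[OF elementary_chart[OF _ bounded_linear_scaleR_left]] by blast

section \<open>The Fubini--Study metric in logarithmic coordinates\<close>

text \<open>Up to normalization the moment map of the diagonal torus; also the diagonal of the
  projector onto the line of \<open>w\<close>.\<close>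

definition weight :: "complex^'m \<Rightarrow> 'm \<Rightarrow> real" where
  "weight w c = (cmod (w $ c))\<^sup>2 / (norm w)\<^sup>2"

definition cov :: "complex^'m \<Rightarrow> complex^'m^'m \<Rightarrow> complex^'m^'m \<Rightarrow> real" where
  "cov w u v = Re ((\<Sum>c\<in>UNIV. weight w c * u $ c $ c * cnj (v $ c $ c))
     - (\<Sum>c\<in>UNIV. weight w c * u $ c $ c) * (\<Sum>c\<in>UNIV. weight w c * cnj (v $ c $ c)))"

lemma sum_weight: "w \<noteq> 0 \<Longrightarrow> (\<Sum>c\<in>UNIV. weight w c) = 1"
proof -
  assume "w \<noteq> 0"
  have "(norm w)\<^sup>2 = (\<Sum>c\<in>UNIV. (cmod (w $ c))\<^sup>2)"
    by (simp add: norm_vec_def L2_set_def sum_nonneg)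
  moreover have "(norm w)\<^sup>2 \<noteq> 0" using \<open>w \<noteq> 0\<close> by simp
  ultimately show ?thesis by (simp add: weight_def flip: sum_divide_distrib)
qed

lemma proj_diag: "proj w $ c $ c = of_real (weight w c)"
  by (simp add: proj_def weight_def complex_norm_square del: of_real_power)

text \<open>Each \<open>herm\<close> is the squared norm \<open>N\<close> times a weighted mean, so
  after division by \<open>N * N\<close> the mean of the product minus the product of the means
  remains.\<close>

lemma fs_lift_dmul:
  assumes "w \<noteq> 0"
  shows "fs_lift w (dmul u w) (dmul v w) = cov w u v"
proof -
  define N where "N = complex_of_real ((norm w)\<^sup>2)"
  have N: "N \<noteq> 0" using assms by (simp add: N_def)
  have wt: "complex_of_real (weight w c) = w $ c * cnj (w $ c) / N" for c
    by (simp add: weight_def N_def complex_norm_square del: of_real_power)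
  have 1: "herm (dmul u w) (dmul v w) = N * (\<Sum>c\<in>UNIV. weight w c * u $ c $ c * cnj (v $ c $ c))"
    using N by (simp add: herm_def dmul_def wt sum_distrib_left mult_ac)
  have 2: "herm (dmul u w) w = N * (\<Sum>c\<in>UNIV. weight w c * u $ c $ c)"
    using N by (simp add: herm_def dmul_def wt sum_distrib_left mult_ac)
  have 3: "herm w (dmul v w) = N * (\<Sum>c\<in>UNIV. weight w c * cnj (v $ c $ c))"
    using N by (simp add: herm_def dmul_def wt sum_distrib_left mult_ac)
  have N4: "complex_of_real (norm w ^ 4) = N * N"
    by (simp add: N_def power4_eq_xxxx power2_eq_square)
  have cancel: "(N * A * N - N * B * (N * C)) / (N * N) = A - B * C" for A B C
    using N by (simp add: field_simps)
  have "fs_lift w (dmul u w) (dmul v w) =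
    Re ((herm (dmul u w) (dmul v w) * N - herm (dmul u w) w * herm w (dmul v w)) / complex_of_real (norm w ^ 4))"
    unfolding fs_lift_def N_def Re_divide_of_real ..
  also have "\<dots> = cov w u v"
    unfolding N4 1 2 3 cancel cov_def ..
  finally show ?thesis .
qed

lemma fs_metric_dmul:
  "w \<noteq> 0 \<Longrightarrow> fs_metric (proj w) (dproj w (dmul u w)) (dproj w (dmul v w)) = cov w u v"
  by (simp add: fs_metric_dproj fs_lift_dmul)

lemma coord_metric_chart:
  "w \<noteq> 0 \<Longrightarrow> coord_metric fs_metric (chart w) u a b = cov (dexp u w) a b"
  by (simp add: coord_metric_def ddir_chart chart_def fs_metric_dmul)

text \<open>The variance identity: mean square minus squared mean is the mean squared deviation. It
  is the source of positivity.\<close>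

lemma cov_self:
  fixes u :: "complex^'m^'m"
  assumes "w \<noteq> 0"
  defines "\<mu> \<equiv> (\<Sum>c\<in>UNIV. complex_of_real (weight w c) * u $ c $ c)"
  shows "cov w u u = (\<Sum>c\<in>UNIV. weight w c * (cmod (u $ c $ c - \<mu>))\<^sup>2)"
proof -
  have s1: "(\<Sum>c\<in>UNIV. complex_of_real (weight w c)) = 1"
    using sum_weight[OF assms(1)] by (metis of_real_1 of_real_sum)
  have cn: "(\<Sum>c\<in>UNIV. complex_of_real (weight w c) * cnj (u $ c $ c)) = cnj \<mu>"
    by (simp add: \<mu>_def)
  have "complex_of_real (\<Sum>c\<in>UNIV. weight w c * (cmod (u $ c $ c - \<mu>))\<^sup>2)
      = (\<Sum>c\<in>UNIV. complex_of_real (weight w c) * ((u $ c $ c - \<mu>) * cnj (u $ c $ c - \<mu>)))"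
    by (simp only: of_real_sum of_real_mult complex_norm_square)
  also have "\<dots> = (\<Sum>c\<in>UNIV. weight w c * u $ c $ c * cnj (u $ c $ c))
      - (\<Sum>c\<in>UNIV. complex_of_real (weight w c) * u $ c $ c) * cnj \<mu>
      - \<mu> * (\<Sum>c\<in>UNIV. complex_of_real (weight w c) * cnj (u $ c $ c))
      + \<mu> * cnj \<mu> * (\<Sum>c\<in>UNIV. complex_of_real (weight w c))"
    by (simp add: algebra_simps sum.distrib sum_subtractf sum_distrib_left)
  also have "\<dots> = (\<Sum>c\<in>UNIV. weight w c * u $ c $ c * cnj (u $ c $ c)) - \<mu> * cnj \<mu>"
    unfolding s1 cn unfolding \<mu>_def[symmetric] by simp
  finally have "(\<Sum>c\<in>UNIV. weight w c * (cmod (u $ c $ c - \<mu>))\<^sup>2)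
      = Re ((\<Sum>c\<in>UNIV. weight w c * u $ c $ c * cnj (u $ c $ c)) - \<mu> * cnj \<mu>)"
    by (metis Re_complex_of_real)
  then show ?thesis unfolding cov_def cn unfolding \<mu>_def[symmetric] ..
qed

lemma cov_add_left: "cov w (u + u') v = cov w u v + cov w u' v"
  by (simp add: cov_def algebra_simps sum.distrib)

lemma cov_add_right: "cov w v (u + u') = cov w v u + cov w v u'"
  by (simp add: cov_def algebra_simps sum.distrib)

section \<open>The complex structure in logarithmic coordinates\<close>

definition imul :: "complex^'m^'m \<Rightarrow> complex^'m^'m" where
  "imul u = (\<chi> a b. \<i> * u $ a $ b)"

lemma imul_imul: "imul (imul u) = - u"
  by (simp add: imul_def vec_eq_iff)

lemma linear_imul: "linear imul"
  by (auto intro!: linearI simp: imul_def vec_eq_iff algebra_simps)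

lemma inj_imul: "inj imul"
  by (auto intro!: injI simp: imul_def vec_eq_iff)

lemma dmul_imul: "dmul (imul u) w = \<i> *s dmul u w"
  by (simp add: imul_def dmul_def vec_eq_iff)

lemma fs_J_dmul:
  "w \<noteq> 0 \<Longrightarrow> fs_J (proj w) (dproj w (dmul u w)) = dproj w (dmul (imul u) w)"
  by (simp add: fs_J_dproj dmul_imul)

section \<open>Parameters and base vectors; \<open>f\<close> gives the block of a coordinate\<close>

locale block_action =
  fixes f :: "'m::finite \<Rightarrow> nat" and j :: nat
begin

text \<open>Entries on blocks below \<open>j\<close> would act on vanishing coordinates, and the
  entry on block \<open>j\<close> is set to 0 to fix the projective scalar. What is left acts with
  discrete stabilizers.\<close>

definition param :: "(complex^'m^'m) set" where
  "param = {u. (\<forall>a b. a \<noteq> b \<longrightarrow> u $ a $ b = 0) \<and> (\<forall>a b. f a = f b \<longrightarrow> u $ a $ a = u $ b $ b)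
     \<and> (\<forall>a. f a \<le> j \<longrightarrow> u $ a $ a = 0)}"

definition re_param :: "(complex^'m^'m) set" where
  "re_param = {u \<in> param. \<forall>a. Im (u $ a $ a) = 0}"

definition im_param :: "(complex^'m^'m) set" where
  "im_param = {u \<in> param. \<forall>a. Re (u $ a $ a) = 0}"

definition chart_dom :: "(complex^'m^'m) set" where
  "chart_dom = {u \<in> param. \<forall>a. \<bar>Im (u $ a $ a)\<bar> < pi}"

text \<open>The last condition makes block \<open>j\<close> non-empty, so that the second one yields
  a nonzero coordinate in it; this coordinate serves as the pivot for normalization.\<close>

definition points :: "(complex^'m) set" where
  "points = {w. (\<forall>a. f a < j \<longrightarrow> w $ a = 0) \<and> (\<forall>a. j \<le> f a \<longrightarrow> (\<exists>b. f b = f a \<and> w $ b \<noteq> 0))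
     \<and> (\<exists>a. f a = j)}"

lemma paramI:
  "(\<And>a b. a \<noteq> b \<Longrightarrow> u $ a $ b = 0) \<Longrightarrow> (\<And>a b. f a = f b \<Longrightarrow> u $ a $ a = u $ b $ b)
    \<Longrightarrow> (\<And>a. f a \<le> j \<Longrightarrow> u $ a $ a = 0) \<Longrightarrow> u \<in> param"
  unfolding param_def by blast

lemma paramD:
  assumes "u \<in> param"
  shows "a \<noteq> b \<Longrightarrow> u $ a $ b = 0" "f a = f b \<Longrightarrow> u $ a $ a = u $ b $ b" "f a \<le> j \<Longrightarrow> u $ a $ a = 0"
  using assms unfolding param_def by blast+

lemma subspace_param: "subspace param"
  unfolding subspace_def
proof (intro conjI ballI allI)
  show "0 \<in> param" by (simp add: param_def)
next
  fix u v assume "u \<in> param" "v \<in> param"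
  note * = paramD[OF this(1)] paramD[OF this(2)]
  show "u + v \<in> param"
    by (rule paramI) (simp_all add: *(1,3,4,6), metis *(2,5))
next
  fix c :: real and u assume "u \<in> param"
  note * = paramD[OF this]
  show "c *\<^sub>R u \<in> param"
    by (rule paramI) (simp_all add: *(1,3), metis *(2))
qed

lemma subspace_re_param: "subspace re_param"
  using subspace_param unfolding subspace_def re_param_def by auto

lemma subspace_im_param: "subspace im_param"
  using subspace_param unfolding subspace_def im_param_def by auto

lemma imul_param: "u \<in> param \<Longrightarrow> imul u \<in> param"
  by (rule paramI) (simp_all add: imul_def paramD(1,3), metis paramD(2))

lemma imul_re_param: "imul ` re_param = im_param"
proof (intro set_eqI iffI)
  fix u assume "u \<in> im_param"
  then have "- imul u \<in> re_param" using imul_param subspace_neg[OF subspace_param]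
    by (auto simp: im_param_def re_param_def imul_def)
  moreover have "imul (- imul u) = u" by (simp add: imul_def vec_eq_iff)
  ultimately show "u \<in> imul ` re_param" by (metis image_eqI)
qed (auto simp: im_param_def re_param_def imul_param, auto simp: imul_def)

lemma param_decomp:
  assumes "u \<in> param"
  obtains s t where "s \<in> re_param" "t \<in> im_param" "u = s + t"
proof
  let ?s = "\<chi> a b. complex_of_real (Re (u $ a $ b))" and ?t = "\<chi> a b. \<i> * complex_of_real (Im (u $ a $ b))"
  have "?s \<in> param" by (rule paramI) (simp_all add: paramD(1,3)[OF assms], metis paramD(2)[OF assms])
  then show "?s \<in> re_param" by (simp add: re_param_def)
  have "?t \<in> param" by (rule paramI) (simp_all add: paramD(1,3)[OF assms], metis paramD(2)[OF assms])
  then show "?t \<in> im_param" by (simp add: im_param_def)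
  show "u = ?s + ?t" by (simp add: vec_eq_iff complex_eq_iff)
qed

lemma points_block: "w \<in> points \<Longrightarrow> j \<le> f a \<Longrightarrow> \<exists>b. f b = f a \<and> w $ b \<noteq> 0"
  unfolding points_def by blast

lemma points_base:
  assumes "w \<in> points"
  shows "\<exists>a. f a = j \<and> w $ a \<noteq> 0"
proof -
  obtain a where "f a = j" using assms unfolding points_def by blast
  then show ?thesis using points_block[OF assms, of a] by simp
qed

lemma points_nonzero: "w \<in> points \<Longrightarrow> w \<noteq> 0"
  using points_base by force

lemma dexp_points: "w \<in> points \<Longrightarrow> dexp u w \<in> points"
  by (auto simp: points_def dexp_def)

lemma param_eqI:
  assumes "u \<in> param" "v \<in> param" "\<And>a. j < f a \<Longrightarrow> u $ a $ a = v $ a $ a"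
  shows "u = v"
  unfolding vec_eq_iff
proof (intro allI)
  fix a b show "u $ a $ b = v $ a $ b"
    using assms(3)[of a] by (cases "a = b"; cases "j < f a") (simp_all add: paramD(1,3) assms(1,2))
qed

text \<open>Zero variance forces every entry of positive weight to equal the mean. Block
  \<open>j\<close> has positive weight and entry 0, so the mean is 0; each higher block contains a
  coordinate of positive weight, and \<open>u\<close> is constant on blocks.\<close>

lemma cov_definite:
  assumes "w \<in> points" "u \<in> param" "cov w u u = 0"
  shows "u = 0"
proof -
  define \<mu> where "\<mu> = (\<Sum>c\<in>UNIV. complex_of_real (weight w c) * u $ c $ c)"
  have w: "w \<noteq> 0" using assms points_nonzero by blast
  have "(\<Sum>c\<in>UNIV. weight w c * (cmod (u $ c $ c - \<mu>))\<^sup>2) = 0"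
    using cov_self[OF w, of u] assms(3) by (simp add: \<mu>_def)
  then have "weight w c * (cmod (u $ c $ c - \<mu>))\<^sup>2 = 0" for c
    by (subst (asm) sum_nonneg_eq_0_iff) (auto simp: weight_def)
  then have *: "w $ c \<noteq> 0 \<Longrightarrow> u $ c $ c = \<mu>" for c
    using w by (auto simp: weight_def)
  obtain a0 where a0: "f a0 = j" "w $ a0 \<noteq> 0" using points_base[OF assms(1)] by blast
  have "\<mu> = 0" using *[OF a0(2)] a0(1) paramD(3)[OF assms(2), of a0] by simp
  have "u $ a $ a = 0" if "j < f a" for a
  proof -
    obtain b where "f b = f a" "w $ b \<noteq> 0" using points_block[OF assms(1), of a] \<open>j < f a\<close> by auto
    then show ?thesis using *[of b] \<open>\<mu> = 0\<close> paramD(2)[OF assms(2), of b a] by simp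
  qed
  then show ?thesis by (intro param_eqI) (use assms subspace_0[OF subspace_param] in auto)
qed

text \<open>A real entry times an imaginary one is imaginary, and \<open>cov\<close> takes real
  parts. No relation between \<open>w\<close> and the parameters enters, so the orthogonality holds
  at all points simultaneously.\<close>

lemma cov_re_im:
  assumes "s \<in> re_param" "t \<in> im_param"
  shows "cov w s t = 0" "cov w t s = 0"
proof -
  have "complex_of_real (Re (s $ a $ a)) = s $ a $ a" "\<i> * complex_of_real (Im (t $ a $ a)) = t $ a $ a" for a
    using assms by (auto simp: re_param_def im_param_def complex_eq_iff)
  then have e: "s $ a $ a = complex_of_real (Re (s $ a $ a))"
    "t $ a $ a = \<i> * complex_of_real (Im (t $ a $ a))" for a by simp_all
  have r: "(\<Sum>c\<in>UNIV. complex_of_real (weight w c) * s $ c $ c) = complex_of_real (\<Sum>c\<in>UNIV. weight w c * Re (s $ c $ c))"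
    by (subst e) simp
  show "cov w s t = 0" "cov w t s = 0" unfolding cov_def
    by (use assms in \<open>simp add: re_param_def im_param_def r\<close>)+
qed

text \<open>Equal points have proportional lifts, and the factor is 1 because both parameters vanish
  on block \<open>j\<close>. Only exponentials can be compared, the parameters being determined up
  to periods.\<close>

lemma chart_inj:
  assumes "w \<in> points" "u \<in> param" "v \<in> param" "chart w u = chart w v"
  shows "exp (u $ a $ a) = exp (v $ a $ a)"
proof -
  have w: "w \<noteq> 0" using assms points_nonzero by blast
  then obtain c where c: "dexp v w = c *s dexp u w"
    using assms(4) proj_eq_iff[of "dexp u w" "dexp v w"] by (auto simp: chart_def)
  then have *: "exp (v $ b $ b) = c * exp (u $ b $ b)" if "w $ b \<noteq> 0" for b
    using that by (simp add: vec_eq_iff dexp_def) (metis mult.assoc mult_cancel_right)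
  obtain a0 where a0: "f a0 = j" "w $ a0 \<noteq> 0" using points_base[OF assms(1)] by blast
  have "c = 1" using *[OF a0(2)] a0(1) paramD(3)[OF assms(2), of a0] paramD(3)[OF assms(3), of a0] by simp
  show ?thesis
  proof (cases "j < f a")
    case True
    then obtain b where "f b = f a" "w $ b \<noteq> 0" using points_block[OF assms(1), of a] by auto
    then show ?thesis using *[of b] \<open>c = 1\<close> paramD(2)[OF assms(2), of b a] paramD(2)[OF assms(3), of b a] by simp
  qed (simp add: paramD(3) assms(2,3))
qed

end

section \<open>Local inverses of the charts\<close>

lemma has_vector_derivative_compose:
  assumes "(c has_vector_derivative X) (at t)" "(g has_derivative D) (at (c t))"
  shows "((\<lambda>s. g (c s)) has_vector_derivative D X) (at t)"
  using vector_derivative_diff_chain_within[OF assms(1) has_derivative_at_withinI[OF assms(2)]]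
  by (simp add: o_def)

text \<open>The difference quotients lie in \<open>A\<close>, and a subspace of a Euclidean space is
  closed.\<close>

lemma has_vector_derivative_mem_subspace:
  fixes c :: "real \<Rightarrow> 'a::euclidean_space"
  assumes "(c has_vector_derivative X) (at t)" "subspace A" "\<forall>\<^sub>F s in nhds t. c s \<in> A"
  shows "X \<in> A"
proof (rule Lim_in_closed_set[of A])
  show "closed A" using assms(2) by (rule closed_subspace)
  have t: "c t \<in> A" using assms(3) eventually_nhds_x_imp_x by blast
  show "\<forall>\<^sub>F s in at t. (1 / (s - t)) *\<^sub>R (c s - c t) \<in> A"
    using assms(3) unfolding eventually_at_filter
    by eventually_elim (use t assms(2) in \<open>auto intro: subspace_scale subspace_diff\<close>)
  have e: "dist ((1 / (s - t)) *\<^sub>R (c s - c t)) X = norm (c s - c t - (s - t) *\<^sub>R X) / \<bar>s - t\<bar>"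
    if "s \<noteq> t" for s
  proof -
    have "(1 / (s - t)) *\<^sub>R (c s - c t) - X = (1 / (s - t)) *\<^sub>R (c s - c t - (s - t) *\<^sub>R X)"
      using that by (simp add: scaleR_diff_right)
    then show ?thesis by (simp add: dist_norm)
  qed
  have "\<forall>e>0. \<exists>d>0. \<forall>s. s \<noteq> t \<and> \<bar>s - t\<bar> < d \<longrightarrow> norm (c s - c t - (s - t) *\<^sub>R X) / \<bar>s - t\<bar> < e"
    using assms(1) unfolding has_vector_derivative_def has_derivative_within' by auto
  then show "((\<lambda>s. (1 / (s - t)) *\<^sub>R (c s - c t)) \<longlongrightarrow> X) (at t)"
    unfolding LIM_def by (metis e dist_real_def)
qed simp

lemma differentiable_vecI:
  fixes g :: "'a::real_normed_vector \<Rightarrow> 'b::real_normed_vector^'n"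
  assumes "\<And>i. (\<lambda>x. g x $ i) differentiable (at x within s)"
  shows "g differentiable (at x within s)"
proof -
  obtain g' where "\<forall>i. ((\<lambda>x. g x $ i) has_derivative g' i) (at x within s)"
    using assms unfolding differentiable_def by metis
  then have "(g has_derivative (\<lambda>h. \<chi> i. g' i h)) (at x within s)"
    by (intro has_derivative_vecI) simp
  then show ?thesis unfolding differentiable_def by blast
qed

lemma smooth_map_on_curve:
  fixes c :: "real \<Rightarrow> 'b::real_normed_vector"
  assumes "smooth_map_on UNIV I c" "open I" "t \<in> I"
  shows "(c has_vector_derivative vector_derivative c (at t)) (at t)"
proof -
  have "Ck_on (Suc 0) UNIV I c" using assms(1) unfolding smooth_map_on_def by blast
  then have "c differentiable (at t)"
    using assms(2,3) by (simp add: differentiable_on_eq_differentiable_at)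
  then show ?thesis using vector_derivative_works by blast
qed

context block_action
begin

text \<open>A witness that the block of \<open>a\<close> does not vanish. It depends on
  \<open>a\<close> only through \<open>f a\<close>, which makes \<open>chart_inv\<close> constant on
  blocks.\<close>

definition rep :: "complex^'m \<Rightarrow> 'm \<Rightarrow> 'm" where
  "rep w a = (SOME b. f b = f a \<and> w $ b \<noteq> 0)"

definition base :: "complex^'m \<Rightarrow> 'm" where
  "base w = (SOME a. f a = j \<and> w $ a \<noteq> 0)"

text \<open>The first quotient is an affine coordinate of the line \<open>P\<close>, namely the
  coordinate \<open>rep w a\<close> over the pivot \<open>base w\<close>. The last factor normalizes
  it to 1 at \<open>proj w\<close>.\<close>

definition ratio :: "complex^'m \<Rightarrow> complex^'m^'m \<Rightarrow> 'm \<Rightarrow> complex" where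
  "ratio w P a = P $ rep w a $ base w / P $ base w $ base w * (w $ base w / w $ rep w a)"

definition chart_inv :: "complex^'m \<Rightarrow> complex^'m^'m \<Rightarrow> complex^'m^'m" where
  "chart_inv w P = (\<chi> a b. if a = b \<and> j < f a then Ln (ratio w P a) else 0)"

text \<open>An open set of the ambient matrix space on which all logarithms are regular. The inverse
  chart is therefore differentiable in the ambient sense, and the chain rule applies to every curve
  through this set.\<close>

definition chart_nbhd :: "complex^'m \<Rightarrow> (complex^'m^'m) set" where
  "chart_nbhd w = {P. P $ base w $ base w \<noteq> 0 \<and> (\<forall>a. j < f a \<longrightarrow> ratio w P a \<notin> \<real>\<^sub>\<le>\<^sub>0)}"

lemma rep:
  assumes "w \<in> points" "j \<le> f a"
  shows "f (rep w a) = f a" "w $ rep w a \<noteq> 0"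
proof -
  have "f (rep w a) = f a \<and> w $ rep w a \<noteq> 0"
    unfolding rep_def by (rule someI_ex[OF points_block[OF assms]])
  then show "f (rep w a) = f a" "w $ rep w a \<noteq> 0" by simp_all
qed

lemma base:
  assumes "w \<in> points"
  shows "f (base w) = j" "w $ base w \<noteq> 0"
proof -
  have "f (base w) = j \<and> w $ base w \<noteq> 0"
    unfolding base_def by (rule someI_ex[OF points_base[OF assms]])
  then show "f (base w) = j" "w $ base w \<noteq> 0" by simp_all
qed

lemma ratio_chart:
  assumes "w \<in> points" "u \<in> param" "j < f a"
  shows "ratio w (chart w u) a = exp (u $ a $ a)"
proof -
  note r = rep[OF assms(1), of a] and b = base[OF assms(1)]
  have "u $ base w $ base w = 0" "u $ rep w a $ rep w a = u $ a $ a"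
    using paramD(3)[OF assms(2), of "base w"] paramD(2)[OF assms(2), of "rep w a" a] r b assms(3) by simp_all
  moreover have "norm (dexp u w) \<noteq> 0" using points_nonzero[OF assms(1)] by simp
  ultimately show ?thesis
    using r b assms(3) by (simp add: ratio_def chart_def proj_def dexp_def)
qed

lemma chart_base_nonzero:
  assumes "w \<in> points" "u \<in> param"
  shows "chart w u $ base w $ base w \<noteq> 0"
proof -
  have "norm (dexp u w) \<noteq> 0" using points_nonzero[OF assms(1)] by simp
  then show ?thesis using base[OF assms(1)] by (simp add: chart_def proj_def dexp_def)
qed

lemma chart_inv_param: "chart_inv w P \<in> param"
proof (rule paramI)
  fix a b assume "f a = f b"
  moreover from this have "rep w a = rep w b" by (simp add: rep_def)
  ultimately show "chart_inv w P $ a $ a = chart_inv w P $ b $ b"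
    by (simp add: chart_inv_def ratio_def)
qed (simp_all add: chart_inv_def)

lemma chart_inv_dom:
  assumes "P \<in> chart_nbhd w"
  shows "chart_inv w P \<in> chart_dom"
proof -
  have "\<bar>Im (Ln (ratio w P a))\<bar> < pi" if "j < f a" for a
  proof -
    have z: "ratio w P a \<notin> \<real>\<^sub>\<le>\<^sub>0" using assms that by (simp add: chart_nbhd_def)
    then have "ratio w P a \<noteq> 0" by auto
    then have "- pi < Im (Ln (ratio w P a))" by (rule mpi_less_Im_Ln)
    then show ?thesis using Im_Ln_less_pi[OF z] by (simp add: abs_less_iff)
  qed
  then show ?thesis by (simp add: chart_dom_def chart_inv_param) (simp add: chart_inv_def)
qed

lemma chart_dom_nbhd:
  assumes "w \<in> points" "u \<in> chart_dom"
  shows "chart w u \<in> chart_nbhd w"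
proof -
  have u: "u \<in> param" using assms by (simp add: chart_dom_def)
  have "exp (u $ a $ a) \<notin> \<real>\<^sub>\<le>\<^sub>0" for a
  proof
    assume n: "exp (u $ a $ a) \<in> \<real>\<^sub>\<le>\<^sub>0"
    have i: "\<bar>Im (u $ a $ a)\<bar> < pi" using assms by (simp add: chart_dom_def)
    have "Re (exp (u $ a $ a)) < 0 \<and> Im (exp (u $ a $ a)) = 0"
      using n exp_not_eq_zero[of "u $ a $ a"] complex_nonpos_Reals_iff complex_eq_iff
      by (metis order_le_less zero_complex.simps)
    \<comment> \<open>On the strip \<open>Ln\<close> undoes \<open>exp\<close>, so this imaginary
      part is that of \<open>u $ a $ a\<close>, which is less than pi.\<close>
    then have "Im (Ln (exp (u $ a $ a))) = pi" using Im_Ln_eq_pi by simp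
    then show False using i by (simp add: abs_less_iff)
  qed
  then show ?thesis using ratio_chart[OF assms(1) u] chart_base_nonzero[OF assms(1) u]
    by (simp add: chart_nbhd_def)
qed

lemma chart_inv_chart:
  assumes "w \<in> points" "u \<in> chart_dom"
  shows "chart_inv w (chart w u) = u"
proof (rule param_eqI)
  show u: "u \<in> param" using assms by (simp add: chart_dom_def)
  fix a assume a: "j < f a"
  have "\<bar>Im (u $ a $ a)\<bar> < pi" using assms by (simp add: chart_dom_def)
  then show "chart_inv w (chart w u) $ a $ a = u $ a $ a"
    using a ratio_chart[OF assms(1) u] by (simp add: chart_inv_def abs_less_iff)
qed (rule chart_inv_param)

text \<open>Valid on the whole orbit: \<open>exp (Ln z) = z\<close> holds for every nonzero
  \<open>z\<close>, and \<open>chart_inv\<close> returns some logarithm of the same point.\<close>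

lemma chart_chart_inv:
  assumes "w \<in> points" "P \<in> chart w ` param"
  shows "chart w (chart_inv w P) = P"
proof -
  obtain u where u: "u \<in> param" "P = chart w u" using assms by blast
  have "exp (chart_inv w P $ a $ a) = exp (u $ a $ a)" for a
  proof (cases "j < f a")
    case True
    then show ?thesis using ratio_chart[OF assms(1) u(1)] u(2) by (simp add: chart_inv_def)
  next
    case False
    then show ?thesis using paramD(3)[OF u(1), of a] by (simp add: chart_inv_def)
  qed
  then show ?thesis by (simp add: u(2) chart_def dexp_def)
qed

text \<open>The image of the chart is cut out of the orbit by an ambient open set, which gives its
  relative openness.\<close>

lemma chart_dom_image:
  assumes "w \<in> points"
  shows "chart w ` chart_dom = chart w ` param \<inter> chart_nbhd w"
proof (intro set_eqI iffI)
  fix P assume "P \<in> chart w ` param \<inter> chart_nbhd w"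
  then show "P \<in> chart w ` chart_dom"
    using chart_chart_inv[OF assms] chart_inv_dom by (metis IntE image_eqI)
qed (use chart_dom_nbhd[OF assms] in \<open>auto simp: chart_dom_def\<close>)

lemma ratio_differentiable:
  assumes "P $ base w $ base w \<noteq> 0"
  shows "(\<lambda>P. ratio w P a) differentiable (at P)"
  unfolding ratio_def
  by (intro differentiable_mult differentiable_divide bounded_linear_imp_differentiable
      bounded_linear_entry differentiable_const assms)

lemma chart_inv_differentiable:
  assumes "P \<in> chart_nbhd w"
  shows "chart_inv w differentiable (at P)"
proof (intro differentiable_vecI)
  fix a b
  have "(\<lambda>P. Ln (ratio w P a)) differentiable (at P)" if "j < f a"
    by (rule differentiable_compose[of Ln])
       (use assms that in \<open>auto simp: chart_nbhd_def intro!: ratio_differentiable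
          field_differentiable_imp_differentiable field_differentiable_at_Ln\<close>)
  moreover have "(\<lambda>P. chart_inv w P $ a $ b) = (if a = b \<and> j < f a then (\<lambda>P. Ln (ratio w P a)) else (\<lambda>P. 0))"
    by (auto simp: chart_inv_def)
  ultimately show "(\<lambda>P. chart_inv w P $ a $ b) differentiable (at P)" by (auto split: if_split)
qed

lemma open_chart_nbhd: "open (chart_nbhd w)"
proof -
  let ?V = "{P::complex^'m^'m. P $ base w $ base w \<noteq> 0}"
  have "continuous_on UNIV (\<lambda>P::complex^'m^'m. P $ base w $ base w)"
    by (intro linear_continuous_on bounded_linear_entry)
  then have V: "open ?V" by (intro open_Collect_neq continuous_on_const)
  have "continuous_on ?V (\<lambda>P. ratio w P a)" for a
    by (intro continuous_at_imp_continuous_on ballI differentiable_imp_continuous_within ratio_differentiable) simp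
  then have "open (?V \<inter> (\<lambda>P. ratio w P a) -` (- \<real>\<^sub>\<le>\<^sub>0))" for a
    using V by (intro continuous_open_preimage) (auto simp: open_Compl)
  then have "open (?V \<inter> (\<Inter>a\<in>{a. j < f a}. ?V \<inter> (\<lambda>P. ratio w P a) -` (- \<real>\<^sub>\<le>\<^sub>0)))"
    using V by (intro open_Int open_INT) auto
  moreover have "?V \<inter> (\<Inter>a\<in>{a. j < f a}. ?V \<inter> (\<lambda>P. ratio w P a) -` (- \<real>\<^sub>\<le>\<^sub>0)) = chart_nbhd w"
    by (auto simp: chart_nbhd_def)
  ultimately show ?thesis by simp
qed

lemma openin_chart_dom: "openin (top_of_set param) chart_dom"
proof -
  have "open {u::complex^'m^'m. \<bar>Im (u $ a $ a)\<bar> < pi}" for a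
    by (intro open_Collect_less continuous_on_rabs continuous_on_Im continuous_on_const
        linear_continuous_on bounded_linear_entry)
  then have "open (\<Inter>a\<in>UNIV. {u::complex^'m^'m. \<bar>Im (u $ a $ a)\<bar> < pi})" by (intro open_INT) auto
  moreover have "chart_dom = param \<inter> (\<Inter>a\<in>UNIV. {u. \<bar>Im (u $ a $ a)\<bar> < pi})"
    by (auto simp: chart_dom_def)
  ultimately show ?thesis by (simp only: openin_open_Int)
qed

text \<open>Immersivity is deduced from the metric: a direction with zero velocity has zero length,
  and \<open>cov\<close> is definite at \<open>dexp u w\<close>.\<close>

lemma ddir_chart_eq_0:
  assumes "w \<in> points" "v \<in> param" "ddir (chart w) u v = 0"
  shows "v = 0"
proof -
  have w: "w \<noteq> 0" using assms points_nonzero by blast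
  have "dmul 0 (dexp u w) = 0" by (simp add: dmul_def vec_eq_iff)
  then have "ddir (chart w) u 0 = 0"
    using w by (simp add: ddir_chart linear_0[OF linear_dproj])
  then have "coord_metric fs_metric (chart w) u v v = coord_metric fs_metric (chart w) u 0 0"
    using assms(3) by (simp add: coord_metric_def)
  then have "cov (dexp u w) v v = 0" using w by (simp add: coord_metric_chart) (simp add: cov_def)
  then show ?thesis using cov_definite[OF dexp_points[OF assms(1)] assms(2)] by blast
qed

lemma local_param_chart:
  assumes "w \<in> points"
  shows "local_param (chart w ` param) param chart_dom (chart w)"
  unfolding local_param_def
proof (intro conjI ballI impI)
  show "smooth_map_on param chart_dom (chart w)" using points_nonzero[OF assms] by (rule smooth_chart)
  show "openin (top_of_set (chart w ` param)) (chart w ` chart_dom)"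
    unfolding chart_dom_image[OF assms] by (intro openin_open_Int open_chart_nbhd)
  have "homeomorphism chart_dom (chart w ` chart_dom) (chart w) (chart_inv w)"
  proof
    show "continuous_on chart_dom (chart w)"
      using chart_has_derivative[OF points_nonzero[OF assms]]
      by (meson has_derivative_continuous continuous_at_imp_continuous_on)
    show "continuous_on (chart w ` chart_dom) (chart_inv w)"
      using chart_inv_differentiable chart_dom_nbhd[OF assms]
      by (intro continuous_at_imp_continuous_on) (auto intro: differentiable_imp_continuous_within)
  qed (use chart_inv_chart[OF assms] in auto)
  then show "\<exists>\<phi>. homeomorphism chart_dom (chart w ` chart_dom) (chart w) \<phi>" by blast
qed (fact subspace_param openin_chart_dom | erule ddir_chart_eq_0[OF assms])+

end

section \<open>Foliations by orbits of subspaces\<close>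

lemma translate_subspace:
  assumes "subspace A" "a \<in> A"
  shows "(\<lambda>x. x + a) ` A = A"
proof
  show "A \<subseteq> (\<lambda>x. x + a) ` A"
  proof
    fix x assume "x \<in> A"
    then have "x - a \<in> A" using assms by (simp add: subspace_diff)
    then show "x \<in> (\<lambda>x. x + a) ` A" by (rule rev_image_eqI) simp
  qed
qed (use assms subspace_add in auto)

lemma chart_dexp_image:
  assumes "subspace A" "a \<in> A"
  shows "chart (dexp a w) ` A = chart w ` A"
proof -
  have "chart (dexp a w) ` A = chart w ` (\<lambda>x. x + a) ` A" by (simp add: image_image chart_dexp)
  then show ?thesis using translate_subspace[OF assms] by simp
qed

lemma continuous_on_chart: "w \<noteq> 0 \<Longrightarrow> continuous_on X (chart w)"
  by (meson chart_has_derivative has_derivative_continuous continuous_at_imp_continuous_on)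

context block_action
begin

text \<open>The last condition makes a leaf meet a chart domain in a single plaque: two points of the
  domain whose images agree up to a translation by \<open>A\<close> already differ by an element of \<open>A\<close>.\<close>

definition leaf_space :: "(complex^'m^'m) set \<Rightarrow> bool" where
  "leaf_space A \<longleftrightarrow> subspace A \<and> A \<subseteq> param \<and>
     (\<forall>a\<in>A. \<forall>u\<in>param. (\<forall>c. \<bar>Im (u $ c $ c)\<bar> < 2 * pi \<and> exp (u $ c $ c) = exp (a $ c $ c)) \<longrightarrow> u \<in> A)"

lemma leaf_spaceD:
  assumes "leaf_space A"
  shows "subspace A" "A \<subseteq> param"
    "a \<in> A \<Longrightarrow> u \<in> param \<Longrightarrow> (\<And>c. \<bar>Im (u $ c $ c)\<bar> < 2 * pi) \<Longrightarrow>
      (\<And>c. exp (u $ c $ c) = exp (a $ c $ c)) \<Longrightarrow> u \<in> A"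
  using assms unfolding leaf_space_def by blast+

text \<open>The whole orbit thus counts as a leaf, so that results on leaves also give its tangent
  spaces.\<close>

lemma leaf_space_param: "leaf_space param"
  by (simp add: leaf_space_def subspace_param)

text \<open>The entries of \<open>u\<close> and \<open>a\<close> differ by integer multiples of 2 pi
  i. As \<open>a\<close> is real, the imaginary part of \<open>u\<close> is such a multiple of 2 pi,
  and the strict bound leaves only 0.\<close>

lemma leaf_space_re: "leaf_space re_param"
  unfolding leaf_space_def
proof (intro conjI ballI impI)
  fix a u assume a: "a \<in> re_param" and u: "u \<in> param"
    and h: "\<forall>c. \<bar>Im (u $ c $ c)\<bar> < 2 * pi \<and> exp (u $ c $ c) = exp (a $ c $ c)"
  have "Im (u $ c $ c) = 0" for c
  proof -
    obtain n :: int where "u $ c $ c = a $ c $ c + (of_int (2 * n) * pi) * \<i>"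
      using h exp_eq by blast
    then have n: "Im (u $ c $ c) = 2 * of_int n * pi" using a by (simp add: re_param_def)
    then have "\<bar>of_int n :: real\<bar> * (2 * pi) < 1 * (2 * pi)"
      using h[rule_format, of c] by (simp add: abs_mult mult_ac)
    then have "\<bar>of_int n :: real\<bar> < 1" using pi_gt_zero mult_less_cancel_right_pos[of "2 * pi"] by fastforce
    then have "n = 0" by linarith
    then show ?thesis using n by simp
  qed
  then show "u \<in> re_param" using u by (simp add: re_param_def)
qed (use subspace_re_param in \<open>auto simp: re_param_def\<close>)

text \<open>Equal exponentials have equal moduli, hence equal real parts.\<close>

lemma leaf_space_im: "leaf_space im_param"
  unfolding leaf_space_def
proof (intro conjI ballI impI)
  fix a u assume a: "a \<in> im_param" and u: "u \<in> param"
    and h: "\<forall>c. \<bar>Im (u $ c $ c)\<bar> < 2 * pi \<and> exp (u $ c $ c) = exp (a $ c $ c)"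
  have "Re (u $ c $ c) = 0" for c
  proof -
    have "exp (Re (u $ c $ c)) = exp (Re (a $ c $ c))" using h by (metis norm_exp_eq_Re)
    then show ?thesis using a by (simp add: im_param_def)
  qed
  then show "u \<in> im_param" using u by (simp add: im_param_def)
qed (use subspace_im_param in \<open>auto simp: im_param_def\<close>)

text \<open>Plaques are images of affine slices of the domain; convexity makes them
  connected.\<close>

lemma convex_chart_dom: "convex chart_dom"
proof (rule convexI)
  fix u v and x y :: real
  assume h: "u \<in> chart_dom" "v \<in> chart_dom" "0 \<le> x" "0 \<le> y" "x + y = 1"
  have "\<bar>Im ((x *\<^sub>R u + y *\<^sub>R v) $ a $ a)\<bar> < pi" for a
  proof -
    have "\<bar>Im ((x *\<^sub>R u + y *\<^sub>R v) $ a $ a)\<bar> \<le> x * \<bar>Im (u $ a $ a)\<bar> + y * \<bar>Im (v $ a $ a)\<bar>"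
      using abs_triangle_ineq[of "x * Im (u $ a $ a)" "y * Im (v $ a $ a)"] h(3,4) by (simp add: abs_mult)
    also have "\<dots> < pi" using h by (intro convex_bound_lt) (auto simp: chart_dom_def)
    finally show ?thesis .
  qed
  then show "x *\<^sub>R u + y *\<^sub>R v \<in> chart_dom"
    using h subspace_param by (simp add: chart_dom_def subspace_add subspace_scale)
qed

end

section \<open>The orbit through a base vector and its leaves\<close>

locale block_orbit = block_action f j for f :: "'m::finite \<Rightarrow> nat" and j :: nat +
  fixes w0 :: "complex^'m"
  assumes w0: "w0 \<in> points"
begin

text \<open>Homogeneous coordinates normalized to agree with \<open>w0\<close> on block
  \<open>j\<close>. Each of them is the centre of a chart, so pointwise statements can be checked at
  parameter 0.\<close>

definition lifts :: "(complex^'m) set" where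
  "lifts = (\<lambda>u. dexp u w0) ` param"

definition orb :: "(complex^'m^'m) set" where
  "orb = chart w0 ` param"

definition leaves :: "(complex^'m^'m) set \<Rightarrow> (complex^'m^'m) set set" where
  "leaves A = (\<lambda>w. chart w ` A) ` lifts"

lemma lifts_points: "w \<in> lifts \<Longrightarrow> w \<in> points"
  using w0 dexp_points by (auto simp: lifts_def)

lemma lifts_nonzero: "w \<in> lifts \<Longrightarrow> w \<noteq> 0"
  using lifts_points points_nonzero by blast

lemma lifts_dexp: "w \<in> lifts \<Longrightarrow> u \<in> param \<Longrightarrow> dexp u w \<in> lifts"
  by (auto simp: lifts_def simp flip: dexp_add intro: subspace_add[OF subspace_param])

lemma lifts_orb: "w \<in> lifts \<Longrightarrow> chart w ` param = orb"
  unfolding lifts_def orb_def using chart_dexp_image[OF subspace_param] by blast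

lemma orb_lifts: "P \<in> orb \<Longrightarrow> \<exists>w\<in>lifts. P = proj w"
  by (auto simp: orb_def lifts_def chart_def)

lemma proj_lifts: "w \<in> lifts \<Longrightarrow> proj w \<in> orb"
  by (auto simp: orb_def lifts_def chart_def)

lemma leaf_eq:
  assumes "leaf_space A" "w \<in> lifts" "w' \<in> lifts" "proj w' \<in> chart w ` A"
  shows "chart w' ` A = chart w ` A"
proof -
  obtain a where a: "a \<in> A" "proj w' = proj (dexp a w)" using assms(4) by (auto simp: chart_def)
  have "chart w' = chart (dexp a w)"
    using chart_cong[of w' "dexp a w"] a(2) lifts_nonzero assms(2,3) by (auto simp: fun_eq_iff)
  then show ?thesis using chart_dexp_image[OF leaf_spaceD(1)[OF assms(1)] a(1)] by simp
qed

lemma leaf_rep: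
  assumes "leaf_space A" "L \<in> leaves A" "P \<in> L"
  shows "\<exists>w\<in>lifts. P = proj w \<and> L = chart w ` A"
proof -
  obtain v a where va: "v \<in> lifts" "L = chart v ` A" "a \<in> A" "P = chart v a"
    using assms(2,3) by (auto simp: leaves_def)
  have c: "dexp a v \<in> lifts" using va lifts_dexp leaf_spaceD(2)[OF assms(1)] by blast
  moreover have "P = proj (dexp a v)" using va by (simp add: chart_def)
  ultimately show ?thesis using leaf_eq[OF assms(1) va(1) c] va(2,3,4) by blast
qed

lemma proj_mem_leaf: "leaf_space A \<Longrightarrow> proj w \<in> chart w ` A"
  using leaf_spaceD(1) subspace_0 chart_0 by (metis image_eqI)

lemma leaf_mem: "w \<in> lifts \<Longrightarrow> chart w ` A \<in> leaves A"
  by (simp add: leaves_def)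

lemma partition_leaves:
  assumes "leaf_space A"
  shows "partition_on orb (leaves A)"
proof (rule partition_onI)
  show "\<Union> (leaves A) = orb"
    using lifts_orb leaf_spaceD(2)[OF assms] orb_lifts proj_mem_leaf[OF assms] by (fastforce simp: leaves_def)
  show "disjnt L L'" if L: "L \<in> leaves A" "L' \<in> leaves A" "L \<noteq> L'" for L L'
  proof (rule ccontr)
    assume "\<not> disjnt L L'"
    then obtain P where P: "P \<in> L" "P \<in> L'" by (auto simp: disjnt_def)
    obtain w where w: "w \<in> lifts" "P = proj w" "L = chart w ` A" using leaf_rep[OF assms L(1) P(1)] by blast
    obtain w' where w': "w' \<in> lifts" "P = proj w'" "L' = chart w' ` A" using leaf_rep[OF assms L(2) P(2)] by blast
    show False using leaf_eq[OF assms w(1) w'(1)] P w w' L(3) by auto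
  qed
  show "{} \<notin> leaves A"
    using subspace_0[OF leaf_spaceD(1)[OF assms]] by (auto simp: leaves_def)
qed

lemma leaf_leaves:
  assumes "leaf_space A" "w \<in> lifts"
  shows "leaf (leaves A) (proj w) = chart w ` A"
  unfolding leaf_def
proof (rule the_equality)
  show "chart w ` A \<in> leaves A \<and> proj w \<in> chart w ` A"
    using leaf_mem proj_mem_leaf assms by blast
  fix L assume "L \<in> leaves A \<and> proj w \<in> L"
  then show "L = chart w ` A"
    using leaf_eq[OF assms(1) _ assms(2)] by (auto simp: leaves_def)
qed

lemma path_connected_leaves:
  assumes "leaf_space A" "L \<in> leaves A"
  shows "path_connected L"
proof -
  obtain w where "w \<in> lifts" "L = chart w ` A" using assms(2) by (auto simp: leaves_def)
  moreover have "path_connected A"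
    using leaf_spaceD(1)[OF assms(1)] by (intro convex_imp_path_connected subspace_imp_convex)
  ultimately show ?thesis
    using path_connected_continuous_image continuous_on_chart lifts_nonzero by blast
qed

text \<open>After recentring, the leaf is \<open>chart w\<close> applied to the coset
  \<open>A + u\<close>. If \<open>u'\<close> in the domain and \<open>a + u\<close> give the same
  point, then \<open>u' - u\<close> and \<open>a\<close> have equal exponentials, and the imaginary
  parts of \<open>u' - u\<close> are below 2 pi, so \<open>leaf_space\<close> applies.\<close>

lemma plaque_leaves:
  assumes A: "leaf_space A" and w: "w \<in> lifts" and u: "u \<in> chart_dom"
    and L: "L \<in> leaves A" "chart w u \<in> L"
  shows "L \<inter> chart w ` chart_dom = chart w ` {u' \<in> chart_dom. u' - u \<in> A}"
proof -
  obtain v where v: "v \<in> lifts" "chart w u = proj v" "L = chart v ` A" using leaf_rep[OF A L] by blast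
  have "chart v = chart (dexp u w)"
    using chart_cong[of v "dexp u w"] v lifts_nonzero w by (auto simp: fun_eq_iff chart_def)
  then have Lw: "L = (\<lambda>a. chart w (a + u)) ` A" using v(3) by (simp add: chart_dexp)
  have par: "u \<in> param" using u by (simp add: chart_dom_def)
  show ?thesis
  proof (intro set_eqI iffI)
    fix P assume "P \<in> L \<inter> chart w ` chart_dom"
    then obtain a u' where h: "a \<in> A" "P = chart w (a + u)" "u' \<in> chart_dom" "P = chart w u'"
      unfolding Lw by blast
    have "u' - u \<in> A"
    proof (rule leaf_spaceD(3)[OF A h(1)])
      show "u' - u \<in> param" using h(3) par subspace_param by (simp add: chart_dom_def subspace_diff)
      fix c
      have "\<bar>Im (u' $ c $ c)\<bar> < pi" "\<bar>Im (u $ c $ c)\<bar> < pi" using h(3) u by (simp_all add: chart_dom_def)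
      then show "\<bar>Im ((u' - u) $ c $ c)\<bar> < 2 * pi" by (simp add: abs_less_iff)
      have "a + u \<in> param" "u' \<in> param"
        using h leaf_spaceD(2)[OF A] par subspace_param by (auto simp: chart_dom_def subspace_add)
      then have "exp ((a + u) $ c $ c) = exp (u' $ c $ c)"
        using chart_inj[OF lifts_points[OF w]] h(2,4) by metis
      then show "exp ((u' - u) $ c $ c) = exp (a $ c $ c)" by (simp add: exp_add exp_diff field_simps)
    qed
    then show "P \<in> chart w ` {u' \<in> chart_dom. u' - u \<in> A}" using h by blast
  next
    fix P assume "P \<in> chart w ` {u' \<in> chart_dom. u' - u \<in> A}"
    then obtain u' where u': "u' \<in> chart_dom" "u' - u \<in> A" "P = chart w u'" by blast
    then have "P \<in> L" unfolding Lw by (intro image_eqI[of _ _ "u' - u"]) auto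
    then show "P \<in> L \<inter> chart w ` chart_dom" using u' by blast
  qed
qed

text \<open>The leaf meets the chart image in a single plaque, which is connected, so the component
  demanded by the definition is the entire intersection.\<close>

lemma foliated_param_chart:
  assumes A: "leaf_space A" and w: "w \<in> lifts"
  shows "foliated_param orb (leaves A) A param chart_dom (chart w)"
  unfolding foliated_param_def
proof (intro conjI ballI impI)
  show "local_param orb param chart_dom (chart w)"
    using local_param_chart[OF lifts_points[OF w]] lifts_orb[OF w] by simp
  fix L u assume h: "L \<in> leaves A" "u \<in> chart_dom" "chart w u \<in> L"
  have "{u' \<in> chart_dom. u' - u \<in> A} = chart_dom \<inter> (\<lambda>x. u + x) ` A"
    by (auto intro!: image_eqI[of _ _ "_ - u"])
  then have "convex {u' \<in> chart_dom. u' - u \<in> A}"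
    using convex_chart_dom convex_translation[OF subspace_imp_convex[OF leaf_spaceD(1)[OF A]]]
    by (simp add: convex_Int)
  then have "connected (chart w ` {u' \<in> chart_dom. u' - u \<in> A})"
    using lifts_nonzero[OF w]
    by (intro connected_continuous_image continuous_on_chart convex_connected) auto
  moreover have "chart w u \<in> chart w ` {u' \<in> chart_dom. u' - u \<in> A}"
    using h subspace_0[OF leaf_spaceD(1)[OF A]] by auto
  ultimately show "connected_component_set (L \<inter> chart w ` chart_dom) (chart w u) = chart w ` {u' \<in> chart_dom. u' - u \<in> A}"
    unfolding plaque_leaves[OF A w h(2,1,3)] by (rule connected_component_eq_self)
qed (use leaf_spaceD[OF A] in auto)

lemma zero_chart_dom: "0 \<in> chart_dom"
  using subspace_0[OF subspace_param] by (simp add: chart_dom_def)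

lemma proj_chart_dom: "proj w \<in> chart w ` chart_dom"
  using zero_chart_dom chart_0 by (metis image_eqI)

lemma foliation_leaves:
  assumes "leaf_space A"
  shows "foliation orb (leaves A)"
  unfolding foliation_def
proof (intro conjI exI[of _ "dim A"] ballI)
  fix x assume "x \<in> orb"
  then obtain w where w: "w \<in> lifts" "x = proj w" using orb_lifts by blast
  then have "foliated_param orb (leaves A) A param chart_dom (chart w) \<and> dim A = dim A \<and> x \<in> chart w ` chart_dom"
    using foliated_param_chart[OF assms] proj_chart_dom by simp
  then show "\<exists>A' S D \<psi>. foliated_param orb (leaves A) A' S D \<psi> \<and> dim A' = dim A \<and> x \<in> \<psi> ` D" by blast
qed (use partition_leaves path_connected_leaves assms in auto)

lemma submanifold_orb: "submanifold (dim param) orb"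
  unfolding submanifold_def
proof
  fix x assume "x \<in> orb"
  then obtain w where "w \<in> lifts" "x = proj w" using orb_lifts by blast
  then show "\<exists>S D \<psi>. local_param orb S D \<psi> \<and> dim S = dim param \<and> x \<in> \<psi> ` D"
    using local_param_chart[OF lifts_points] lifts_orb proj_chart_dom by metis
qed

lemma chart_has_vector_derivative:
  assumes "w \<noteq> 0" "(\<gamma> has_vector_derivative v) (at t)"
  shows "((\<lambda>s. chart w (\<gamma> s)) has_vector_derivative dproj (dexp (\<gamma> t) w) (dmul v (dexp (\<gamma> t) w))) (at t)"
  by (rule has_vector_derivative_compose[OF assms(2) chart_has_derivative[OF assms(1)]])

text \<open>A parameter \<open>v\<close> in \<open>A\<close> is realized by the line
  \<open>t *\<^sub>R v\<close>. Conversely a curve in the leaf is pulled back by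
  \<open>chart_inv\<close>; near 0 the pullback runs inside \<open>A\<close>, so its velocity lies
  in \<open>A\<close> and is mapped to the given vector.\<close>

lemma tangent_leaf:
  assumes A: "leaf_space A" and w: "w \<in> lifts"
  shows "tangent_space (chart w ` A) (proj w) = (\<lambda>v. dproj w (dmul v w)) ` A"
proof (intro set_eqI iffI)
  fix X assume "X \<in> (\<lambda>v. dproj w (dmul v w)) ` A"
  then obtain v where v: "v \<in> A" "X = dproj w (dmul v w)" by blast
  let ?c = "\<lambda>t::real. chart w (t *\<^sub>R v)"
  have "((\<lambda>t::real. t *\<^sub>R v) has_vector_derivative v) (at 0)"
    by (auto intro!: derivative_eq_intros)
  then have "(?c has_vector_derivative X) (at 0)"
    using chart_has_vector_derivative[OF lifts_nonzero[OF w]] v(2) by fastforce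
  then have "X = vector_derivative ?c (at 0)" by (rule vector_derivative_at[symmetric])
  moreover have "smooth_map_on UNIV {-1<..<1} ?c" using smooth_chart_line lifts_nonzero w by blast
  moreover have "?c ` {-1<..<1} \<subseteq> chart w ` A" using v(1) leaf_spaceD(1)[OF A] by (auto simp: subspace_scale)
  moreover have "(1::real) > 0" "?c 0 = proj w" by simp_all
  ultimately show "X \<in> tangent_space (chart w ` A) (proj w)" unfolding tangent_space_def by blast
next
  fix X assume "X \<in> tangent_space (chart w ` A) (proj w)"
  then obtain c :: "real \<Rightarrow> complex^'m^'m" and e where c: "X = vector_derivative c (at 0)" "e > 0"
    "smooth_map_on UNIV {-e<..<e} c" "c ` {-e<..<e} \<subseteq> chart w ` A" "c 0 = proj w"
    unfolding tangent_space_def by blast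
  have D: "(c has_vector_derivative X) (at 0)"
    using smooth_map_on_curve[OF c(3)] c(1,2) by simp
  note wp = lifts_points[OF w]
  have P: "proj w \<in> chart_nbhd w" using chart_dom_nbhd[OF wp zero_chart_dom] by simp
  obtain G where G: "(chart_inv w has_derivative G) (at (c 0))"
    using chart_inv_differentiable[OF P] c(5) by (auto simp: differentiable_def)
  define \<gamma> where "\<gamma> t = chart_inv w (c t)" for t
  have \<gamma>: "(\<gamma> has_vector_derivative G X) (at 0)"
    unfolding \<gamma>_def by (rule has_vector_derivative_compose[OF D G])
  have "isCont c 0" using D has_vector_derivative_continuous by blast
  then have "(c \<longlongrightarrow> c 0) (nhds 0)"
    unfolding isCont_def tendsto_at_iff_tendsto_nhds .
  then have "\<forall>\<^sub>F t in nhds 0. c t \<in> chart_nbhd w"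
    by (rule topological_tendstoD) (use open_chart_nbhd P c(5) in auto)
  moreover have "\<forall>\<^sub>F t in nhds 0. t \<in> {-e<..<e}" using c(2) by (intro eventually_nhds_in_open) auto
  ultimately have ev: "\<forall>\<^sub>F t in nhds 0. c t = chart w (\<gamma> t) \<and> \<gamma> t \<in> A"
  proof eventually_elim
    case (elim t)
    then have "c t \<in> chart w ` A" using c(4) by blast
    then obtain a where a: "a \<in> A" "c t = chart w a" by blast
    then have 1: "c t = chart w (\<gamma> t)"
      using chart_chart_inv[OF wp] leaf_spaceD(2)[OF A] unfolding \<gamma>_def by (metis image_eqI subsetD)
    have d: "\<gamma> t \<in> chart_dom" unfolding \<gamma>_def using elim chart_inv_dom by blast
    \<comment> \<open>The parameter \<open>a\<close> is chosen separately for each \<open>t\<close>,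
      with no continuity in \<open>t\<close>. The logarithm \<open>\<gamma> t\<close> has the same
      exponential and lies in the strip, so \<open>leaf_space\<close> places it in
      \<open>A\<close>.\<close>
    have "\<gamma> t \<in> A"
    proof (rule leaf_spaceD(3)[OF A a(1)])
      show "\<gamma> t \<in> param" using d by (simp add: chart_dom_def)
      fix i
      have "\<bar>Im (\<gamma> t $ i $ i)\<bar> < pi" using d by (simp add: chart_dom_def)
      then show "\<bar>Im (\<gamma> t $ i $ i)\<bar> < 2 * pi" using pi_gt_zero by linarith
      show "exp (\<gamma> t $ i $ i) = exp (a $ i $ i)"
        using chart_inj[OF wp _ _ , of "\<gamma> t" a] 1 a d leaf_spaceD(2)[OF A] by (auto simp: chart_dom_def)
    qed
    then show ?case using 1 by blast
  qed
  have GA: "G X \<in> A"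
    by (rule has_vector_derivative_mem_subspace[OF \<gamma> leaf_spaceD(1)[OF A]]) (use ev in eventually_elim, simp)
  have \<gamma>0: "\<gamma> 0 = 0" using chart_inv_chart[OF wp zero_chart_dom] by (simp add: \<gamma>_def c(5))
  have "((\<lambda>t. chart w (\<gamma> t)) has_vector_derivative dproj w (dmul (G X) w)) (at 0)"
    using chart_has_vector_derivative[OF lifts_nonzero[OF w] \<gamma>] by (simp add: \<gamma>0)
  moreover have "\<forall>\<^sub>F t in nhds 0. chart w (\<gamma> t) = c t" using ev by eventually_elim simp
  ultimately have "(c has_vector_derivative dproj w (dmul (G X) w)) (at 0)"
    using has_vector_derivative_cong_ev[where x = 0 and S = UNIV and f = "\<lambda>t. chart w (\<gamma> t)" and g = c]
    by (auto simp: \<gamma>0 c(5))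
  then have "X = dproj w (dmul (G X) w)" using D vector_derivative_at by blast
  then show "X \<in> (\<lambda>v. dproj w (dmul v w)) ` A" using GA by blast
qed

lemma tangent_orb:
  "w \<in> lifts \<Longrightarrow> tangent_space orb (proj w) = (\<lambda>v. dproj w (dmul v w)) ` param"
  using tangent_leaf[OF leaf_space_param] lifts_orb by simp

lemma leaf_tangent_leaves:
  "leaf_space A \<Longrightarrow> w \<in> lifts \<Longrightarrow> leaf_tangent (leaves A) (proj w) = (\<lambda>v. dproj w (dmul v w)) ` A"
  by (simp add: leaf_tangent_def leaf_leaves tangent_leaf)

end

section \<open>Riemannian and Lagrangian properties\<close>

text \<open>An arbitrary chart is differentiable only within \<open>D\<close>, which is open merely
  relative to \<open>S\<close>. A line in a direction of \<open>S\<close> meets \<open>D\<close> in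
  an open set of times, so \<open>ddir\<close> is a genuine derivative there.\<close>

lemma local_param_line:
  assumes "local_param N S D \<psi>" "u \<in> D" "v \<in> S"
  shows "((\<lambda>t::real. \<psi> (u + t *\<^sub>R v)) has_vector_derivative ddir \<psi> u v) (at 0)"
    and "\<forall>\<^sub>F t in nhds 0. u + t *\<^sub>R v \<in> D"
proof -
  have S: "subspace S" and o: "openin (top_of_set S) D" and sm: "smooth_map_on S D \<psi>"
    using assms(1) by (simp_all add: local_param_def)
  obtain U where U: "open U" "D = S \<inter> U" using o by (auto simp: openin_open)
  define T where "T = {t::real. u + t *\<^sub>R v \<in> D}"
  have "u + t *\<^sub>R v \<in> S" for t using S U assms(2,3) by (auto intro: subspace_add subspace_scale)
  then have "T = (\<lambda>t. u + t *\<^sub>R v) -` U" using U by (auto simp: T_def)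
  then have T: "open T" using U(1) by (auto intro!: open_vimage continuous_intros)
  have 0: "0 \<in> T" using assms(2) by (simp add: T_def)
  show "\<forall>\<^sub>F t in nhds 0. u + t *\<^sub>R v \<in> D"
    using eventually_nhds_in_open[OF T 0] by (simp add: T_def)
  have "Ck_on (Suc 0) S D \<psi>" using sm unfolding smooth_map_on_def by blast
  then have "\<psi> differentiable (at u within D)" using assms(2) by (simp add: differentiable_on_def)
  then have "\<psi> differentiable (at u within (\<lambda>t. u + t *\<^sub>R v) ` T)"
    by (rule differentiable_subset) (auto simp: T_def)
  then have "\<psi> differentiable (at (u + 0 *\<^sub>R v) within (\<lambda>t. u + t *\<^sub>R v) ` T)" by simp
  moreover have "(\<lambda>t. u + t *\<^sub>R v) differentiable (at 0 within T)"
    by (intro differentiable_add differentiable_const bounded_linear_imp_differentiable bounded_linear_scaleR_left)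
  ultimately have "(\<lambda>t. \<psi> (u + t *\<^sub>R v)) differentiable (at 0 within T)"
    by (rule differentiable_in_compose[where f = \<psi> and g = "\<lambda>t. u + t *\<^sub>R v"])
  then have "(\<lambda>t. \<psi> (u + t *\<^sub>R v)) differentiable (at 0)"
    unfolding at_within_open[OF 0 T] .
  then show "((\<lambda>t::real. \<psi> (u + t *\<^sub>R v)) has_vector_derivative ddir \<psi> u v) (at 0)"
    unfolding ddir_def by (simp only: vector_derivative_works)
qed

lemma weight_dexp_im:
  assumes "\<And>c. Re (a $ c $ c) = 0"
  shows "weight (dexp a w) = weight w"
proof -
  have "cmod (dexp a w $ c) = cmod (w $ c)" for c by (simp add: dexp_def norm_mult assms)
  then show ?thesis by (simp add: fun_eq_iff weight_def norm_vec_def)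
qed

lemma dmul_add: "dmul (u + v) w = dmul u w + dmul v w"
  by (simp add: dmul_def vec_eq_iff algebra_simps)

lemma dmul_scaleR: "dmul (r *\<^sub>R u) w = r *\<^sub>R dmul u w"
  by (simp add: dmul_def vec_eq_iff)

lemma linear_dproj_dmul: "w \<noteq> 0 \<Longrightarrow> linear (\<lambda>v. dproj w (dmul v w))"
  by (rule linearI) (simp_all add: dmul_add dmul_scaleR linear_add[OF linear_dproj] linear_scale[OF linear_dproj])

text \<open>The diagonal of the projector consists of the weights. Along \<open>v\<close> the
  squared modulus of coordinate \<open>c\<close> grows at the relative rate
  \<open>2 * Re (v $ c $ c)\<close>, and the normalization subtracts the mean rate
  \<open>2 * \<mu>\<close>.\<close>

lemma dproj_dmul_diag:
  fixes v :: "complex^'m^'m"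
  assumes w: "w \<noteq> 0" and v: "\<And>c. Im (v $ c $ c) = 0"
  defines "\<mu> \<equiv> (\<Sum>c\<in>UNIV. weight w c * Re (v $ c $ c))"
  shows "dproj w (dmul v w) $ c $ c = of_real (2 * weight w c * (Re (v $ c $ c) - \<mu>))"
proof -
  define N where "N = w \<bullet> w"
  have N: "N \<noteq> 0" using w by (simp add: N_def)
  have r: "v $ d $ d = complex_of_real (Re (v $ d $ d))" for d
    using v by (simp add: complex_eq_iff)
  have wt: "weight w d = (cmod (w $ d))\<^sup>2 / N" for d by (simp add: weight_def N_def dot_square_norm)
  have "herm (dmul v w) w = (\<Sum>d\<in>UNIV. v $ d $ d * (w $ d * cnj (w $ d)))"
    by (simp add: herm_def dmul_def mult_ac)
  also have "\<dots> = (\<Sum>d\<in>UNIV. complex_of_real (Re (v $ d $ d)) * of_real ((cmod (w $ d))\<^sup>2))"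
    by (subst r) (simp only: complex_norm_square)
  also have "\<dots> = of_real (N * \<mu>)"
    using N by (simp add: \<mu>_def wt sum_distrib_left mult_ac)
  finally have "complex_of_real (2 * (w \<bullet> dmul v w)) = of_real (2 * (N * \<mu>))"
    using herm_Re[of w "dmul v w"] by simp
  then have m: "2 * (w \<bullet> dmul v w) = 2 * (N * \<mu>)" using of_real_eq_iff by blast
  have "dproj w (dmul v w) $ c $ c =
     2 * complex_of_real (Re (v $ c $ c)) * (w $ c * cnj (w $ c)) / of_real N
     - of_real (2 * (N * \<mu>)) * (w $ c * cnj (w $ c)) / of_real (N^2)"
    unfolding dproj_eq[OF w] m N_def[symmetric] by (subst r) (simp add: dmul_def v mult_ac complex_eq_iff)
  also have "\<dots> = of_real (2 * Re (v $ c $ c) * (cmod (w $ c))\<^sup>2 / N - 2 * (N * \<mu>) * (cmod (w $ c))\<^sup>2 / N^2)"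
    by (simp only: of_real_diff of_real_mult of_real_divide of_real_numeral complex_norm_square)
  also have "2 * Re (v $ c $ c) * (cmod (w $ c))\<^sup>2 / N - 2 * (N * \<mu>) * (cmod (w $ c))\<^sup>2 / N^2
     = 2 * weight w c * (Re (v $ c $ c) - \<mu>)"
    using N by (simp add: wt field_simps power2_eq_square)
  finally show ?thesis .
qed

text \<open>For a vector normal to the torus orbits the squared length depends only on the diagonal
  entries of the base point and of the vector, that is, on torus-invariant data.\<close>

lemma fs_metric_horizontal:
  assumes w: "w \<noteq> 0" and v: "\<And>c. Im (v $ c $ c) = 0"
  defines "X \<equiv> dproj w (dmul v w)"
  shows "fs_metric (proj w) X X = (\<Sum>c\<in>UNIV. (Re (X $ c $ c))\<^sup>2 / (4 * Re (proj w $ c $ c)))"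
proof -
  define \<mu> where "\<mu> = (\<Sum>c\<in>UNIV. weight w c * Re (v $ c $ c))"
  have r: "v $ d $ d = complex_of_real (Re (v $ d $ d))" for d
    using v by (simp add: complex_eq_iff)
  have \<mu>: "(\<Sum>c\<in>UNIV. complex_of_real (weight w c) * v $ c $ c) = of_real \<mu>"
    unfolding \<mu>_def by (subst r) simp
  have "weight w c * (cmod (v $ c $ c - of_real \<mu>))\<^sup>2 = (Re (X $ c $ c))\<^sup>2 / (4 * Re (proj w $ c $ c))" for c
  proof -
    have "v $ c $ c - of_real \<mu> = of_real (Re (v $ c $ c) - \<mu>)" by (subst r) simp
    then have *: "(cmod (v $ c $ c - of_real \<mu>))\<^sup>2 = (Re (v $ c $ c) - \<mu>)\<^sup>2" by (simp del: of_real_diff)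
    \<comment> \<open>For a vanishing weight the diagonal entry of \<open>X\<close> vanishes as
      well, and both sides are 0 because 0 / 0 = 0.\<close>
    show ?thesis
      unfolding X_def dproj_dmul_diag[OF w v] proj_diag \<mu>_def[symmetric] * Re_complex_of_real
      by (cases "weight w c = 0") (simp_all add: power_mult_distrib power2_eq_square)
  qed
  then show ?thesis using fs_metric_dmul[OF w, of v v] cov_self[OF w, of v] unfolding \<mu> X_def by simp
qed

context block_orbit
begin

lemma fs_J_tangent:
  assumes "P \<in> orb"
  shows "fs_J P ` tangent_space orb P \<subseteq> tangent_space orb P"
proof -
  obtain w where w: "w \<in> lifts" "P = proj w" using orb_lifts assms by blast
  show ?thesis
    unfolding w(2) tangent_orb[OF w(1)] using fs_J_dmul[OF lifts_nonzero[OF w(1)]] imul_param by auto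
qed

text \<open>Split \<open>v = s + t\<close> into real and imaginary part. Normality tested on
  \<open>t\<close> itself gives \<open>cov w t t = 0\<close>, since \<open>s\<close> and
  \<open>t\<close> are orthogonal, and definiteness kills \<open>t\<close>.\<close>

lemma leaf_normal_im:
  assumes w: "w \<in> lifts"
  shows "leaf_normal orb fs_metric (leaves im_param) (proj w) = (\<lambda>v. dproj w (dmul v w)) ` re_param"
proof (intro set_eqI iffI)
  note nz = lifts_nonzero[OF w]
  fix X assume "X \<in> leaf_normal orb fs_metric (leaves im_param) (proj w)"
  then obtain v where v: "v \<in> param" "X = dproj w (dmul v w)"
    and n: "\<And>e. e \<in> im_param \<Longrightarrow> cov w e v = 0"
    using w nz by (auto simp: leaf_normal_def tangent_orb leaf_tangent_leaves leaf_space_im fs_metric_dmul)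
  obtain s t where st: "s \<in> re_param" "t \<in> im_param" "v = s + t" using param_decomp[OF v(1)] .
  have "cov w t t = 0" using n[OF st(2)] cov_re_im[OF st(1,2)] by (simp add: st(3) cov_add_right)
  then have "t = 0" using cov_definite[OF lifts_points[OF w]] st(2) by (simp add: im_param_def)
  then show "X \<in> (\<lambda>v. dproj w (dmul v w)) ` re_param" using v(2) st by simp
next
  note nz = lifts_nonzero[OF w]
  fix X assume "X \<in> (\<lambda>v. dproj w (dmul v w)) ` re_param"
  then obtain v where v: "v \<in> re_param" "X = dproj w (dmul v w)" by blast
  then have "v \<in> param" by (simp add: re_param_def)
  then show "X \<in> leaf_normal orb fs_metric (leaves im_param) (proj w)"
    using v w nz cov_re_im(2)[OF v(1)]
    by (auto simp: leaf_normal_def tangent_orb leaf_tangent_leaves leaf_space_im fs_metric_dmul)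
qed

lemma leaf_tangent_re:
  "P \<in> orb \<Longrightarrow> leaf_tangent (leaves re_param) P = leaf_normal orb fs_metric (leaves im_param) P"
  using orb_lifts leaf_tangent_leaves[OF leaf_space_re] leaf_normal_im by metis

lemma leaf_im_diag:
  assumes "L \<in> leaves im_param" "P \<in> L" "Q \<in> L"
  shows "P $ c $ c = Q $ c $ c"
proof -
  obtain w where w: "P = proj w" "L = chart w ` im_param" using leaf_rep[OF leaf_space_im assms(1,2)] by blast
  then obtain a where "a \<in> im_param" "Q = proj (dexp a w)" using assms(3) by (auto simp: chart_def)
  then show ?thesis using w weight_dexp_im[of a w] by (simp add: proj_diag im_param_def)
qed

lemma fs_metric_leaf_normal:
  assumes "P \<in> orb" "X \<in> leaf_normal orb fs_metric (leaves im_param) P"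
  shows "fs_metric P X X = (\<Sum>c\<in>UNIV. (Re (X $ c $ c))\<^sup>2 / (4 * Re (P $ c $ c)))"
proof -
  obtain w where w: "w \<in> lifts" "P = proj w" using assms(1) orb_lifts by blast
  then obtain v where v: "v \<in> re_param" "X = dproj w (dmul v w)" using assms(2) leaf_normal_im by blast
  show ?thesis unfolding w(2) v(2)
    by (rule fs_metric_horizontal) (use v(1) lifts_nonzero w(1) in \<open>auto simp: re_param_def\<close>)
qed

text \<open>The chart is arbitrary, so no formula for it is available. But for each small
  \<open>t\<close> the points with parameters \<open>u + t *\<^sub>R v\<close> and
  \<open>u' + t *\<^sub>R v'\<close> lie in one plaque, their difference being in \<open>A\<close>.
  Hence their diagonal entries agree for all small \<open>t\<close>, and so do the diagonals of the
  velocities; these data determine the length of a normal vector.\<close>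

lemma leaf_holonomy_isometric:
  assumes "leaf_holonomy orb fs_metric (leaves im_param) x X y Y"
  shows "fs_metric x X X = fs_metric y Y Y"
  using assms
proof induction
  case (plaque A S D \<psi> u u' v v')
  have lp: "local_param orb S D \<psi>" and A: "subspace A"
    and pl: "\<And>L u. L \<in> leaves im_param \<Longrightarrow> u \<in> D \<Longrightarrow> \<psi> u \<in> L \<Longrightarrow>
      connected_component_set (L \<inter> \<psi> ` D) (\<psi> u) = \<psi> ` {u'\<in>D. u' - u \<in> A}"
    using plaque(1) by (auto simp: foliated_param_def)
  have orb: "\<psi> x \<in> orb" if "x \<in> D" for x
    using lp that openin_imp_subset by (fastforce simp: local_param_def)
  have diag: "\<psi> x $ c $ c = \<psi> y $ c $ c" if "x \<in> D" "y \<in> D" "y - x \<in> A" for x y c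
  proof -
    have "\<psi> x \<in> \<Union> (leaves im_param)"
      using orb[OF that(1)] partition_onD1[OF partition_leaves[OF leaf_space_im]] by simp
    then obtain L where L: "L \<in> leaves im_param" "\<psi> x \<in> L" by blast
    have "\<psi> y \<in> connected_component_set (L \<inter> \<psi> ` D) (\<psi> x)" using pl[OF L(1) that(1) L(2)] that by blast
    then have "\<psi> y \<in> L" using connected_component_in by fastforce
    then show ?thesis using leaf_im_diag L by blast
  qed
  have entry: "((\<lambda>t. \<psi> (x + t *\<^sub>R z) $ c $ c) has_vector_derivative ddir \<psi> x z $ c $ c) (at 0)"
    if "x \<in> D" "z \<in> S" for x z c
    by (rule bounded_linear.has_vector_derivative[OF bounded_linear_entry local_param_line(1)[OF lp that]])
  have ev: "\<forall>\<^sub>F t in nhds (0::real). \<psi> (u + t *\<^sub>R v) $ c $ c = \<psi> (u' + t *\<^sub>R v') $ c $ c" for c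
    using local_param_line(2)[OF lp plaque(2,5)] local_param_line(2)[OF lp plaque(3,6)]
  proof eventually_elim
    case (elim t)
    have "u' + t *\<^sub>R v' - (u + t *\<^sub>R v) = (u' - u) + t *\<^sub>R (v' - v)" by (simp add: algebra_simps)
    moreover have "(u' - u) + t *\<^sub>R (v' - v) \<in> A"
      using plaque(4,7) A by (intro subspace_add subspace_scale)
    ultimately have "u' + t *\<^sub>R v' - (u + t *\<^sub>R v) \<in> A" by (simp only:)
    then show ?case using diag elim by blast
  qed
  have "ddir \<psi> u v $ c $ c = ddir \<psi> u' v' $ c $ c" for c
  proof -
    have "((\<lambda>t. \<psi> (u' + t *\<^sub>R v') $ c $ c) has_vector_derivative ddir \<psi> u v $ c $ c) (at 0)"
      using entry[OF plaque(2,5), of c] ev[of c] eventually_nhds_x_imp_x[OF ev[of c]]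
        has_vector_derivative_cong_ev[where x = 0 and S = UNIV and f = "\<lambda>t. \<psi> (u + t *\<^sub>R v) $ c $ c"
          and g = "\<lambda>t. \<psi> (u' + t *\<^sub>R v') $ c $ c"] by simp
    then show ?thesis using entry[OF plaque(3,6)] vector_derivative_unique_at by blast
  qed
  then show ?case
    using fs_metric_leaf_normal[OF orb[OF plaque(2)] plaque(8)] fs_metric_leaf_normal[OF orb[OF plaque(3)] plaque(9)]
      diag[OF plaque(2,3,4)] by simp
qed simp

lemma riemannian_foliation_im: "riemannian_foliation orb fs_metric (leaves im_param)"
  unfolding riemannian_foliation_def using foliation_leaves[OF leaf_space_im] leaf_holonomy_isometric by blast

section \<open>Dimensions and the Lagrangian property\<close>

lemma dproj_dmul_eq_0:
  assumes "w \<in> lifts" "v \<in> param" "dproj w (dmul v w) = 0"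
  shows "v = 0"
  using ddir_chart_eq_0[of w v 0] assms lifts_points lifts_nonzero by (simp add: ddir_chart)

lemma dim_tangent:
  assumes "w \<in> lifts" "A \<subseteq> param" "subspace A"
  shows "dim ((\<lambda>v. dproj w (dmul v w)) ` A) = dim A"
proof (rule dim_image_eq)
  note l = linear_dproj_dmul[OF lifts_nonzero[OF assms(1)]]
  show "linear (\<lambda>v. dproj w (dmul v w))" by (rule l)
  show "inj_on (\<lambda>v. dproj w (dmul v w)) (span A)"
  proof (rule inj_onI)
    fix x y assume h: "x \<in> span A" "y \<in> span A" "dproj w (dmul x w) = dproj w (dmul y w)"
    have "span A = A" using assms(3) by simp
    then have "x - y \<in> param" using h(1,2) assms(2,3) subspace_diff by blast
    moreover have "dproj w (dmul (x - y) w) = 0" using linear_diff[OF l, of x y] h(3) by simp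
    ultimately show "x = y" using dproj_dmul_eq_0[OF assms(1)] by fastforce
  qed
qed

lemma dim_im_param: "dim im_param = dim re_param"
  unfolding imul_re_param[symmetric]
  using dim_image_eq[OF linear_imul] inj_imul by (metis inj_on_subset subset_UNIV)

lemma dim_param: "dim param = 2 * dim re_param"
proof -
  have "{x + y |x y. x \<in> re_param \<and> y \<in> im_param} = param"
  proof (intro set_eqI iffI)
    fix u assume "u \<in> param"
    then show "u \<in> {x + y |x y. x \<in> re_param \<and> y \<in> im_param}" using param_decomp by blast
  qed (auto simp: re_param_def im_param_def intro: subspace_add[OF subspace_param])
  moreover have "re_param \<inter> im_param = {0}"
  proof -
    have "u = 0" if "u \<in> re_param" "u \<in> im_param" for u
      using that subspace_0[OF subspace_param]
      by (intro param_eqI) (auto simp: re_param_def im_param_def complex_eq_iff)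
    then show ?thesis using subspace_0[OF subspace_re_param] subspace_0[OF subspace_im_param] by blast
  qed
  ultimately show ?thesis
    using dim_sums_Int[OF subspace_re_param subspace_im_param] by (simp add: dim_im_param)
qed

text \<open>\<open>imul\<close> exchanges \<open>re_param\<close> and \<open>im_param\<close>, which
  are orthogonal for \<open>cov\<close> and have equal dimension.\<close>

lemma lagrangian_leaf:
  assumes A: "A = re_param \<or> A = im_param" and L: "L \<in> leaves A"
  shows "lagrangian orb fs_metric fs_J L"
  unfolding lagrangian_def
proof (intro ballI conjI)
  have ls: "leaf_space A" using A leaf_space_re leaf_space_im by blast
  fix x assume "x \<in> L"
  then obtain w where w: "w \<in> lifts" "x = proj w" "L = chart w ` A" using leaf_rep[OF ls L] by blast
  note nz = lifts_nonzero[OF w(1)]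
  have T: "tangent_space L x = (\<lambda>v. dproj w (dmul v w)) ` A" using tangent_leaf[OF ls w(1)] w by simp
  have "dim A = dim re_param" using A dim_im_param by auto
  then show "2 * dim (tangent_space L x) = dim (tangent_space orb x)"
    unfolding T unfolding w(2) tangent_orb[OF w(1)]
    using dim_tangent[OF w(1) leaf_spaceD(2,1)[OF ls]] dim_tangent[OF w(1) subset_refl subspace_param] dim_param by simp
  fix X Y assume "X \<in> tangent_space L x" "Y \<in> tangent_space L x"
  then obtain u v where uv: "u \<in> A" "v \<in> A" "X = dproj w (dmul u w)" "Y = dproj w (dmul v w)" unfolding T by blast
  have "kahler_form fs_metric fs_J x X Y = cov w (imul u) v"
    unfolding kahler_form_def uv w(2) using nz by (simp add: fs_J_dmul fs_metric_dmul)
  also have "\<dots> = 0"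
    using A
  proof
    assume "A = re_param"
    then show ?thesis using uv imul_re_param cov_re_im(2) by blast
  next
    assume im: "A = im_param"
    then obtain r where r: "r \<in> re_param" "u = imul r" using uv imul_re_param by blast
    have "imul u \<in> re_param" unfolding r(2) imul_imul using r(1) subspace_neg[OF subspace_re_param] by blast
    then show ?thesis using uv im cov_re_im(1) by blast
  qed
  finally show "kahler_form fs_metric fs_J x X Y = 0" .
qed

lemma leaves_orthogonal:
  assumes "L1 \<in> leaves im_param" "L2 \<in> leaves re_param" "x \<in> L1 \<inter> L2"
    and "X \<in> tangent_space L1 x" "Y \<in> tangent_space L2 x"
  shows "fs_metric x X Y = 0"
proof -
  obtain w where w: "w \<in> lifts" "x = proj w" "L1 = chart w ` im_param"
    using leaf_rep[OF leaf_space_im assms(1)] assms(3) by blast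
  obtain w' where w': "w' \<in> lifts" "x = proj w'" "L2 = chart w' ` re_param"
    using leaf_rep[OF leaf_space_re assms(2)] assms(3) by blast
  have "chart w' = chart w" using chart_cong[of w' w] w w' lifts_nonzero by (auto simp: fun_eq_iff)
  then show ?thesis
    using assms(4,5) tangent_leaf[OF leaf_space_im w(1)] tangent_leaf[OF leaf_space_re w(1)] w w'
      lifts_nonzero[OF w(1)] cov_re_im(2)
    by (auto simp: fs_metric_dmul)
qed

end

section \<open>Total geodesy\<close>

lemma has_vector_derivative_zero_constant_on:
  fixes p :: "real \<Rightarrow> 'b::real_normed_vector"
  assumes "convex T" "\<And>t. t \<in> T \<Longrightarrow> (p has_vector_derivative 0) (at t)" "s \<in> T" "t \<in> T"
  shows "p s = p t"
proof -
  have "\<exists>k. \<forall>x\<in>T. p x = k"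
    by (rule has_derivative_zero_constant[OF assms(1)])
       (use assms(2) has_derivative_at_withinI in \<open>fastforce simp: has_vector_derivative_def\<close>)
  then show ?thesis using assms(3,4) by auto
qed

lemma smooth_map_on_curve2:
  fixes c :: "real \<Rightarrow> 'b::real_normed_vector"
  assumes "smooth_map_on UNIV I c" "open I" "t \<in> I"
  shows "(\<lambda>s. vector_derivative c (at s)) differentiable (at t)"
proof -
  have "Ck_on (Suc (Suc 0)) UNIV I c" using assms(1) unfolding smooth_map_on_def by blast
  then have "(\<lambda>s. ddir c s 1) differentiable (at t)"
    using assms(2,3) by (simp add: differentiable_on_eq_differentiable_at)
  moreover have e: "ddir c s 1 = vector_derivative c (at s)" if "s \<in> I" for s
    using ddir_eq[OF smooth_map_on_curve[OF assms(1,2) that, unfolded has_vector_derivative_def], of 1] by simp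
  ultimately obtain D where D: "((\<lambda>s. ddir c s 1) has_derivative D) (at t)"
    unfolding differentiable_def by blast
  have "((\<lambda>s. vector_derivative c (at s)) has_derivative D) (at t)"
    by (rule has_derivative_transform_within_open[OF D assms(2,3) e])
  then show ?thesis unfolding differentiable_def by blast
qed

lemma differentiable_entry:
  fixes c :: "'a::real_normed_vector \<Rightarrow> complex^'n^'m"
  shows "c differentiable (at t) \<Longrightarrow> (\<lambda>t. c t $ a $ b) differentiable (at t)"
  using differentiable_compose[OF bounded_linear_imp_differentiable[OF bounded_linear_entry]] by blast

text \<open>The coefficient of \<open>a $ c $ c\<close> in \<open>cov (dexp y w) a e\<close> before
  the real part is taken. It is written through the diagonal of the chart, and with
  \<open>(- 1) *\<close> for subtraction, so that the rules of \<open>elementary\<close>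
  apply.\<close>

definition cov_kernel :: "complex^'m \<Rightarrow> complex^'m^'m \<Rightarrow> 'm \<Rightarrow> complex^'m^'m \<Rightarrow> complex" where
  "cov_kernel w e c y = chart w y $ c $ c * (cnj (e $ c $ c) + (- 1) * (\<Sum>d\<in>UNIV. chart w y $ d $ d * cnj (e $ d $ d)))"

lemma cov_eq_kernel:
  "cov (dexp y w) a e = Re (\<Sum>c\<in>UNIV. cov_kernel w e c y * a $ c $ c)"
proof -
  define W where "W c = complex_of_real (weight (dexp y w) c)" for c
  define E where "E = (\<Sum>d\<in>UNIV. W d * cnj (e $ d $ d))"
  have "(\<Sum>c\<in>UNIV. W c * (cnj (e $ c $ c) + (- 1) * E) * a $ c $ c)
      = (\<Sum>c\<in>UNIV. W c * a $ c $ c * cnj (e $ c $ c)) - (\<Sum>c\<in>UNIV. W c * a $ c $ c) * E"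
    by (simp add: algebra_simps sum_subtractf sum_distrib_left)
  then show ?thesis unfolding cov_def cov_kernel_def chart_def proj_diag E_def W_def by simp
qed

lemma cov_kernel_derivative:
  assumes "w \<noteq> 0"
  shows "\<exists>K. \<forall>c y. (cov_kernel w e c has_derivative K c y) (at y)"
proof -
  have "elementary (\<lambda>y. chart w y $ c $ c)" for c
    by (rule elementary_chart[OF assms bounded_linear_ident])
  then have "elementary (cov_kernel w e c)" for c
    unfolding cov_kernel_def
    by (intro elementary.mult elementary.add elementary.const elementary_sum)
  then have "\<forall>c. \<exists>K. \<forall>y. (cov_kernel w e c has_derivative K y) (at y)"
    using elementary_derivative by blast
  then show ?thesis by (rule choice)
qed

lemma ddir_cov_im:
  assumes "\<And>c. Re (e $ c $ c) = 0"
  shows "ddir (\<lambda>y. cov (dexp y w) a b) u e = 0"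
proof -
  have "cov (dexp (u + t *\<^sub>R e) w) a b = cov (dexp u w) a b" for t
    using weight_dexp_im[of "t *\<^sub>R e" "dexp u w"] assms by (simp add: cov_def add.commute[of u] dexp_add)
  then show ?thesis by (simp add: ddir_def)
qed

text \<open>The geodesic equation in an imaginary direction \<open>e\<close> says that the momentum
  \<open>g (\<gamma>', e)\<close> is conserved, because the metric is invariant under the torus.\<close>

lemma momentum_derivative:
  assumes w: "w \<noteq> 0" and e: "\<And>c. Re (e $ c $ c) = 0"
    and d1: "(\<gamma> has_vector_derivative \<gamma>' t) (at t)" and d2: "(\<gamma>' has_vector_derivative b) (at t)"
  shows "((\<lambda>s. cov (dexp (\<gamma> s) w) (\<gamma>' s) e) has_vector_derivative
    coord_metric fs_metric (chart w) (\<gamma> t) b e + christoffel fs_metric (chart w) (\<gamma> t) (\<gamma>' t) (\<gamma>' t) e) (at t)"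
proof -
  obtain K where K: "\<And>c y. (cov_kernel w e c has_derivative K c y) (at y)"
    using cov_kernel_derivative[OF w] by metis
  let ?a = "\<gamma>' t"
  have "((\<lambda>y. cov (dexp y w) ?a e) has_derivative (\<lambda>v. Re (\<Sum>c\<in>UNIV. K c (\<gamma> t) v * ?a $ c $ c))) (at (\<gamma> t))"
    unfolding cov_eq_kernel
    by (intro has_derivative_Re has_derivative_sum has_derivative_mult_left K)
  then have "ddir (\<lambda>y. cov (dexp y w) ?a e) (\<gamma> t) ?a = Re (\<Sum>c\<in>UNIV. K c (\<gamma> t) ?a * ?a $ c $ c)"
    by (rule ddir_eq)
  \<comment> \<open>With both arguments equal to the velocity the first two terms coincide and
    absorb the division by 2; the third is a derivative in the imaginary direction \<open>e\<close>
    and vanishes.\<close>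
  then have chr: "christoffel fs_metric (chart w) (\<gamma> t) ?a ?a e = Re (\<Sum>c\<in>UNIV. K c (\<gamma> t) ?a * ?a $ c $ c)"
    using ddir_cov_im[OF e, of w ?a ?a "\<gamma> t"] w by (simp add: christoffel_def coord_metric_chart)
  have "((\<lambda>s. cov_kernel w e c (\<gamma> s) * \<gamma>' s $ c $ c) has_vector_derivative
      (cov_kernel w e c (\<gamma> t) * b $ c $ c + K c (\<gamma> t) ?a * ?a $ c $ c)) (at t)" for c
    by (intro has_vector_derivative_mult has_vector_derivative_compose[OF d1 K]
        bounded_linear.has_vector_derivative[OF bounded_linear_entry d2])
  then have "((\<lambda>s. Re (\<Sum>c\<in>UNIV. cov_kernel w e c (\<gamma> s) * \<gamma>' s $ c $ c)) has_vector_derivative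
      Re (\<Sum>c\<in>UNIV. cov_kernel w e c (\<gamma> t) * b $ c $ c + K c (\<gamma> t) ?a * ?a $ c $ c)) (at t)"
    by (intro bounded_linear.has_vector_derivative[OF bounded_linear_Re] has_vector_derivative_sum)
  then show ?thesis
    unfolding chr coord_metric_chart[OF w] cov_eq_kernel by (simp only: sum.distrib plus_complex.sel)
qed

context block_action
begin

text \<open>The quotient rule for \<open>ratio\<close> combined with the derivative of
  \<open>Ln\<close>. An explicit formula in \<open>P\<close> and \<open>X\<close> is used because
  along a geodesic both vary, and the resulting coordinate velocity must be differentiated once
  more.\<close>

definition chart_inv_deriv :: "complex^'m \<Rightarrow> complex^'m^'m \<Rightarrow> complex^'m^'m \<Rightarrow> complex^'m^'m" where
  "chart_inv_deriv w P X = (\<chi> a b. if a = b \<and> j < f a then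
     inverse (ratio w P a) * ((X $ rep w a $ base w * P $ base w $ base w - P $ rep w a $ base w * X $ base w $ base w)
       / (P $ base w $ base w * P $ base w $ base w) * (w $ base w / w $ rep w a)) else 0)"

lemma chart_inv_has_derivative:
  assumes "P \<in> chart_nbhd w"
  shows "(chart_inv w has_derivative chart_inv_deriv w P) (at P)"
proof (intro has_derivative_vecI)
  fix a b
  have nz: "P $ base w $ base w \<noteq> 0" using assms by (simp add: chart_nbhd_def)
  have r: "((\<lambda>P. ratio w P a) has_derivative (\<lambda>X. (X $ rep w a $ base w * P $ base w $ base w - P $ rep w a $ base w * X $ base w $ base w)
       / (P $ base w $ base w * P $ base w $ base w) * (w $ base w / w $ rep w a))) (at P)"
    unfolding ratio_def
    by (intro has_derivative_mult_left has_derivative_divide' bounded_linear_imp_has_derivative bounded_linear_entry nz)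
  have "((\<lambda>P. Ln (ratio w P a)) has_derivative (\<lambda>X. chart_inv_deriv w P X $ a $ a)) (at P)" if "j < f a"
  proof -
    have z: "ratio w P a \<notin> \<real>\<^sub>\<le>\<^sub>0" using assms that by (simp add: chart_nbhd_def)
    have L: "(Ln has_derivative (\<lambda>x. inverse (ratio w P a) * x)) (at (ratio w P a))"
      using has_field_derivative_Ln[OF z] unfolding has_field_derivative_def .
    show ?thesis
      using has_derivative_compose[of "\<lambda>P. ratio w P a" _ P UNIV Ln "\<lambda>x. inverse (ratio w P a) * x", OF r L] that
      by (simp add: chart_inv_deriv_def)
  qed
  moreover have "(\<lambda>P. chart_inv w P $ a $ b) = (if a = b \<and> j < f a then (\<lambda>P. Ln (ratio w P a)) else (\<lambda>P. 0))"
    by (auto simp: chart_inv_def)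
  moreover have "(\<lambda>X. chart_inv_deriv w P X $ a $ b) = (\<lambda>X. 0)" if "\<not> (a = b \<and> j < f a)"
    using that by (auto simp: chart_inv_deriv_def)
  ultimately show "((\<lambda>P. chart_inv w P $ a $ b) has_derivative (\<lambda>X. chart_inv_deriv w P X $ a $ b)) (at P)"
    by (cases "a = b \<and> j < f a") auto
qed

lemma chart_inv_deriv_differentiable:
  assumes "c differentiable (at t)" "X differentiable (at t)" "c t \<in> chart_nbhd w"
  shows "(\<lambda>s. chart_inv_deriv w (c s) (X s)) differentiable (at t)"
proof (intro differentiable_vecI)
  fix a b
  have nz: "c t $ base w $ base w \<noteq> 0" using assms(3) by (simp add: chart_nbhd_def)
  have "(\<lambda>s. chart_inv_deriv w (c s) (X s) $ a $ a) differentiable (at t)" if "j < f a"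
  proof -
    have "ratio w (c t) a \<noteq> 0" using assms(3) that by (force simp: chart_nbhd_def)
    moreover have "(\<lambda>s. ratio w (c s) a) differentiable (at t)"
      by (rule differentiable_compose[OF ratio_differentiable assms(1)]) (rule nz)
    moreover define k where "k = w $ base w / w $ rep w a"
    ultimately have "(\<lambda>s. inverse (ratio w (c s) a) * ((X s $ rep w a $ base w * c s $ base w $ base w
         - c s $ rep w a $ base w * X s $ base w $ base w) / (c s $ base w $ base w * c s $ base w $ base w) * k))
       differentiable (at t)"
      using nz by (intro differentiable_mult differentiable_inverse differentiable_divide
          differentiable_diff differentiable_entry differentiable_const assms) auto
    then show ?thesis using that by (simp add: chart_inv_deriv_def k_def)
  qed
  moreover have "(\<lambda>s. chart_inv_deriv w (c s) (X s) $ a $ b) = (\<lambda>s. 0)" if "\<not> (a = b \<and> j < f a)"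
    using that by (auto simp: chart_inv_deriv_def)
  ultimately show "(\<lambda>s. chart_inv_deriv w (c s) (X s) $ a $ b) differentiable (at t)"
    by (cases "a = b \<and> j < f a") auto
qed

end

context block_orbit
begin

lemma totally_geodesic_re:
  assumes "L \<in> leaves re_param"
  shows "totally_geodesic orb fs_metric L"
  unfolding totally_geodesic_def
proof (intro allI impI, elim conjE)
  fix I c t0
  assume geo: "geodesic orb fs_metric I c" and t0: "t0 \<in> I" "c t0 \<in> L"
    and tan: "vector_derivative c (at t0) \<in> tangent_space L (c t0)"
  obtain w where w: "w \<in> lifts" "c t0 = proj w" "L = chart w ` re_param"
    using leaf_rep[OF leaf_space_re assms t0(2)] by blast
  note nz = lifts_nonzero[OF w(1)] and wp = lifts_points[OF w(1)]
  have I: "open I" and sm: "smooth_map_on UNIV I c" and cI: "c ` I \<subseteq> orb"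
    using geo by (auto simp: geodesic_def)
  note cd = smooth_map_on_curve[OF sm I]
  have "continuous_on I c"
    using cd has_vector_derivative_continuous continuous_at_imp_continuous_on by blast
  then have "open (I \<inter> c -` chart_nbhd w)"
    using I open_chart_nbhd by (rule continuous_open_preimage)
  moreover have "t0 \<in> I \<inter> c -` chart_nbhd w"
    using t0 chart_dom_nbhd[OF wp zero_chart_dom] by (simp add: w(2))
  ultimately obtain \<epsilon> where \<epsilon>: "\<epsilon> > 0" "ball t0 \<epsilon> \<subseteq> I \<inter> c -` chart_nbhd w"
    unfolding open_contains_ball by blast
  \<comment> \<open>A ball is taken because the momenta and the imaginary parts are shown to be
    constant from zero derivatives, which requires a convex set of times.\<close>
  define I' where "I' = ball t0 \<epsilon>"
  have I': "open I'" "I' \<subseteq> I" "convex I'" "t0 \<in> I'" using \<epsilon> by (auto simp: I'_def)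
  have nb: "c t \<in> chart_nbhd w" if "t \<in> I'" for t using \<epsilon> that by (auto simp: I'_def)
  define \<gamma> where "\<gamma> t = chart_inv w (c t)" for t
  define \<gamma>' where "\<gamma>' t = vector_derivative \<gamma> (at t)" for t
  define \<gamma>'' where "\<gamma>'' t = vector_derivative \<gamma>' (at t)" for t
  have c\<gamma>: "chart w (\<gamma> t) = c t" "\<gamma> t \<in> chart_dom" if "t \<in> I'" for t
  proof -
    have "c t \<in> chart w ` param" using that I' cI lifts_orb[OF w(1)] by blast
    then show "chart w (\<gamma> t) = c t" unfolding \<gamma>_def using chart_chart_inv[OF wp] by blast
    show "\<gamma> t \<in> chart_dom" unfolding \<gamma>_def using chart_inv_dom nb that by blast
  qed
  have d0: "(\<gamma> has_vector_derivative chart_inv_deriv w (c t) (vector_derivative c (at t))) (at t)" if "t \<in> I'" for t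
    unfolding \<gamma>_def
    by (rule has_vector_derivative_compose[OF cd chart_inv_has_derivative[OF nb]]) (use that I' in auto)
  then have \<gamma>'_eq: "\<gamma>' t = chart_inv_deriv w (c t) (vector_derivative c (at t))" if "t \<in> I'" for t
    unfolding \<gamma>'_def using that by (intro vector_derivative_at)
  then have d1: "(\<gamma> has_vector_derivative \<gamma>' t) (at t)" if "t \<in> I'" for t using d0 that by simp
  have d2: "(\<gamma>' has_vector_derivative \<gamma>'' t) (at t)" if "t \<in> I'" for t
  proof -
    have tI: "t \<in> I" using that I'(2) by blast
    have "c differentiable (at t)" using cd[OF tI] by (rule differentiableI_vector)
    then have "(\<lambda>s. chart_inv_deriv w (c s) (vector_derivative c (at s))) differentiable (at t)"
      using smooth_map_on_curve2[OF sm I tI] nb[OF that]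
      by (rule chart_inv_deriv_differentiable[where c = c and X = "\<lambda>s. vector_derivative c (at s)"])
    then obtain D where "((\<lambda>s. chart_inv_deriv w (c s) (vector_derivative c (at s))) has_vector_derivative D) (at t)"
      using vector_derivative_works by blast
    then have "(\<gamma>' has_vector_derivative D) (at t)"
      by (rule has_vector_derivative_transform_within_open[OF _ I'(1) that]) (simp add: \<gamma>'_eq)
    then show ?thesis unfolding \<gamma>''_def using vector_derivative_at by metis
  qed
  have \<gamma>p: "\<gamma> t \<in> param" for t unfolding \<gamma>_def by (rule chart_inv_param)
  have \<gamma>'p: "\<gamma>' t \<in> param" if "t \<in> I'" for t
    by (rule has_vector_derivative_mem_subspace[OF d1[OF that] subspace_param]) (simp add: \<gamma>p)
  have ge: "coord_metric fs_metric (chart w) (\<gamma> t) (\<gamma>'' t) e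
      + christoffel fs_metric (chart w) (\<gamma> t) (\<gamma>' t) (\<gamma>' t) e = 0" if "t \<in> I'" "e \<in> param" for t e
  proof -
    have "local_param orb param chart_dom (chart w)"
      using local_param_chart[OF wp] lifts_orb[OF w(1)] by simp
    moreover have "\<forall>t\<in>I'. \<gamma> t \<in> chart_dom \<and> chart w (\<gamma> t) = c t" using c\<gamma> by blast
    ultimately show ?thesis
      using geo I'(1,2) that unfolding geodesic_def Let_def \<gamma>''_def[abs_def] \<gamma>'_def[abs_def] by blast
  qed
  have \<gamma>0: "\<gamma> t0 = 0" using chart_inv_chart[OF wp zero_chart_dom] by (simp add: \<gamma>_def w(2))
  obtain s where s: "s \<in> re_param" "vector_derivative c (at t0) = dproj w (dmul s w)"
    using tan tangent_leaf[OF leaf_space_re w(1)] w by auto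
  have "((\<lambda>t. chart w (\<gamma> t)) has_vector_derivative dproj w (dmul (\<gamma>' t0) w)) (at t0)"
    using chart_has_vector_derivative[OF nz d1[OF I'(4)]] by (simp add: \<gamma>0)
  then have "(c has_vector_derivative dproj w (dmul (\<gamma>' t0) w)) (at t0)"
    by (rule has_vector_derivative_transform_within_open[OF _ I'(1,4)]) (use c\<gamma> in simp)
  then have "dproj w (dmul (\<gamma>' t0) w) = dproj w (dmul s w)"
    using s(2) by (simp add: vector_derivative_at)
  then have "dproj w (dmul (\<gamma>' t0 - s) w) = 0"
    using linear_diff[OF linear_dproj_dmul[OF nz], of "\<gamma>' t0" s] by simp
  moreover have "\<gamma>' t0 - s \<in> param"
    using \<gamma>'p[OF I'(4)] s(1) subspace_diff[OF subspace_param] by (simp add: re_param_def)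
  \<comment> \<open>By immersivity the tangent vector determines the coordinate velocity, which is
    therefore real at \<open>t0\<close>.\<close>
  ultimately have "\<gamma>' t0 = s" using dproj_dmul_eq_0[OF w(1)] by fastforce
  then have \<gamma>'0: "\<gamma>' t0 \<in> re_param" using s(1) by simp
  have mom: "cov (dexp (\<gamma> t) w) (\<gamma>' t) e = 0" if "t \<in> I'" "e \<in> im_param" for t e
  proof -
    have e: "e \<in> param" "\<And>c. Re (e $ c $ c) = 0" using that(2) by (auto simp: im_param_def)
    have "((\<lambda>s. cov (dexp (\<gamma> s) w) (\<gamma>' s) e) has_vector_derivative 0) (at r)" if "r \<in> I'" for r
      using momentum_derivative[OF nz e(2) d1[OF that] d2[OF that]] ge[OF that e(1)] by simp
    then have "cov (dexp (\<gamma> t) w) (\<gamma>' t) e = cov (dexp (\<gamma> t0) w) (\<gamma>' t0) e"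
      by (rule has_vector_derivative_zero_constant_on[OF I'(3) _ that(1) I'(4)])
    then show ?thesis using cov_re_im(1)[OF \<gamma>'0 that(2)] by simp
  qed
  \<comment> \<open>The momentum against the imaginary part \<open>e\<close> of the velocity is
    \<open>cov (dexp (\<gamma> t) w) e e\<close>, because real and imaginary directions are
    orthogonal at every point; definiteness gives \<open>e = 0\<close>.\<close>
  have re: "\<gamma>' t \<in> re_param" if t: "t \<in> I'" for t
  proof -
    obtain s e where se: "s \<in> re_param" "e \<in> im_param" "\<gamma>' t = s + e" using param_decomp[OF \<gamma>'p[OF t]] .
    have "cov (dexp (\<gamma> t) w) e e = 0"
      using mom[OF t se(2)] cov_re_im(1)[OF se(1,2)] by (simp add: se(3) cov_add_left)
    then have "e = 0" using cov_definite[OF dexp_points[OF wp]] se(2) by (simp add: im_param_def)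
    then show ?thesis using se by simp
  qed
  have "c t \<in> L" if "t \<in> I'" for t
  proof -
    have "Im (\<gamma> t $ a $ a) = 0" for a
    proof -
      have "((\<lambda>r. Im (\<gamma> r $ a $ a)) has_vector_derivative 0) (at r)" if "r \<in> I'" for r
        using bounded_linear.has_vector_derivative[OF bounded_linear_Im
            bounded_linear.has_vector_derivative[OF bounded_linear_entry[of a a] d1[OF that]]] re[OF that]
        by (simp add: re_param_def)
      then have "Im (\<gamma> t $ a $ a) = Im (\<gamma> t0 $ a $ a)"
        by (rule has_vector_derivative_zero_constant_on[OF I'(3) _ that I'(4)])
      then show ?thesis by (simp add: \<gamma>0)
    qed
    then have "\<gamma> t \<in> re_param" using \<gamma>p by (simp add: re_param_def)
    then show ?thesis using c\<gamma>(1)[OF that] w(3) by (metis image_eqI)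
  qed
  then show "\<exists>e>0. \<forall>t\<in>I. \<bar>t - t0\<bar> < e \<longrightarrow> c t \<in> L"
    using \<epsilon>(1) unfolding I'_def by (auto intro!: exI[of _ \<epsilon>] simp: dist_real_def abs_minus_commute)
qed

lemma totally_geodesic_foliation_re: "totally_geodesic_foliation orb fs_metric (leaves re_param)"
  unfolding totally_geodesic_foliation_def
  using foliation_leaves[OF leaf_space_re] totally_geodesic_re by blast

lemma lagrangian_frame_leaves: "lagrangian_frame orb fs_metric fs_J (leaves im_param) (leaves re_param)"
  unfolding lagrangian_frame_def
proof (intro conjI ballI)
  show "lagrangian orb fs_metric fs_J L" if "L \<in> leaves im_param \<union> leaves re_param" for L
    using that lagrangian_leaf by blast
  show "fs_metric x u v = 0"
    if "L1 \<in> leaves im_param" "L2 \<in> leaves re_param" "x \<in> L1 \<inter> L2"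
      "u \<in> tangent_space L1 x" "v \<in> tangent_space L2 x" for L1 L2 x u v
    using that by (rule leaves_orthogonal)
qed (intro foliation_leaves leaf_space_im leaf_space_re riemannian_foliation_im totally_geodesic_foliation_re)+

end

section \<open>Orbits of the block diagonal groups\<close>

lemma block_diag_mult: "block_diag idx z *v w = (\<chi> a. z (fst (idx a)) * w $ a)"
  by (simp add: block_diag_def matrix_vector_mult_def vec_eq_iff if_distrib[of "\<lambda>x. x * _"] cong: if_cong)

lemma det_block_diag: "det (block_diag idx z) = (\<Prod>a\<in>UNIV. z (fst (idx a)))"
  by (subst det_diagonal) (simp_all add: block_diag_def)

lemma mat_mult_block_diag: "mat c ** block_diag idx z = block_diag idx (\<lambda>i. c * z i)"
  by (simp add: block_diag_def matrix_matrix_mult_def mat_def vec_eq_iff if_distrib[of "\<lambda>x. x * _"] cong: if_cong)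

section \<open>Identification of the group orbits with the charts\<close>

locale partition_action =
  fixes n j :: nat and k :: "nat list" and idx :: "'m::finite \<Rightarrow> nat \<times> nat"
  assumes partition: "partition_of n k" and labelling: "block_labelling k idx" and j_le: "j \<le> length k"
begin

sublocale block_action "\<lambda>a. fst (idx a)" j .

lemma label_le: "fst (idx a) \<le> length k"
proof -
  have "idx a \<in> (SIGMA j:{0..length k}. {1..(if j = 0 then 1 else k ! (j - 1))})"
    using labelling unfolding block_labelling_def bij_betw_def by blast
  then show ?thesis by (cases "idx a") auto
qed

lemma label_surj:
  assumes "i \<le> length k"
  shows "\<exists>a. fst (idx a) = i"
proof -
  have "1 \<le> (if i = 0 then 1 else k ! (i - 1))"
    using partition assms by (auto simp: partition_of_def Suc_le_eq)
  then have "(i, 1) \<in> (SIGMA j:{0..length k}. {1..(if j = 0 then 1 else k ! (j - 1))})"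
    using assms by auto
  then obtain a where "idx a = (i, 1)"
    using labelling unfolding block_labelling_def bij_betw_def by (metis imageE)
  then show ?thesis by (metis fst_conv)
qed

definition admissible :: "(nat \<Rightarrow> complex) \<Rightarrow> bool" where
  "admissible z \<longleftrightarrow> (\<forall>i\<le>length k. z i \<noteq> 0) \<and> (\<forall>i. 1 \<le> i \<and> i < j \<longrightarrow> z i = 1) \<and>
     z 0 * (\<Prod>i\<in>{1..length k}. z i ^ (k ! (i - 1))) = 1"

lemma G_group_eq: "G_group k idx j = {psl_class (block_diag idx z) | z. admissible z}"
  by (simp add: G_group_def admissible_def)

lemma block_diag_eq_iff:
  "block_diag idx y = block_diag idx z \<longleftrightarrow> (\<forall>i\<le>length k. y i = z i)"
proof
  assume h: "block_diag idx y = block_diag idx z"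
  show "\<forall>i\<le>length k. y i = z i"
  proof (intro allI impI)
    fix i assume "i \<le> length k"
    then obtain a where a: "fst (idx a) = i" using label_surj by blast
    have "block_diag idx y $ a $ a = block_diag idx z $ a $ a" using h by simp
    then show "y i = z i" by (simp add: block_diag_def a)
  qed
next
  assume "\<forall>i\<le>length k. y i = z i"
  then show "block_diag idx y = block_diag idx z" using label_le by (simp add: block_diag_def vec_eq_iff)
qed

text \<open>The intersection is one of sets of classes, so a common class may have different
  representatives in the two groups. They differ by a scalar of modulus 1, which preserves the
  moduli of the entries. Conversely the product of the remaining factors has modulus 1, so its
  inverse \<open>z 0\<close> is its conjugate, as in the definition of the torus.\<close>

lemma T_group_eq:
  "T_group k idx j = {psl_class (block_diag idx z) | z. admissible z \<and> (\<forall>i\<le>length k. cmod (z i) = 1)}"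
proof (intro set_eqI iffI)
  fix X assume "X \<in> T_group k idx j"
  then obtain z t where z: "admissible z" "X = psl_class (block_diag idx z)"
    and t: "\<And>i. i \<in> {1..length k} \<Longrightarrow> cmod (t i) = 1"
    and X: "X = psl_class (block_diag idx (\<lambda>i. if i = 0
        then (\<Prod>r\<in>{1..length k}. cnj (t r) ^ (k ! (r - 1))) else t i))"
    unfolding T_group_def G_group_eq torus_def by blast
  let ?t = "\<lambda>i. if i = 0 then (\<Prod>r\<in>{1..length k}. cnj (t r) ^ (k ! (r - 1))) else t i"
  have t1: "cmod (?t i) = 1" if "i \<le> length k" for i
    using t that by (auto simp: norm_power simp flip: prod_norm intro!: prod.neutral)
  have "block_diag idx z = mat 1 ** block_diag idx z" "det (mat 1 :: complex^'m^'m) = 1" by simp_all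
  then have "block_diag idx z \<in> psl_class (block_diag idx z)"
    unfolding psl_class_def using norm_one by blast
  then have "block_diag idx z \<in> psl_class (block_diag idx ?t)" using z(2) X by argo
  then obtain c where c: "cmod c = 1" "block_diag idx z = mat c ** block_diag idx ?t"
    unfolding psl_class_def by blast
  have zt: "\<forall>i\<le>length k. z i = c * ?t i"
    using c(2) unfolding mat_mult_block_diag by (simp only: block_diag_eq_iff)
  have "cmod (z i) = 1" if "i \<le> length k" for i
    using zt[rule_format, OF that] t1[OF that] c(1) by (simp only: norm_mult mult_1)
  then show "X \<in> {psl_class (block_diag idx z) | z. admissible z \<and> (\<forall>i\<le>length k. cmod (z i) = 1)}"
    using z by blast
next
  fix X assume "X \<in> {psl_class (block_diag idx z) | z. admissible z \<and> (\<forall>i\<le>length k. cmod (z i) = 1)}"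
  then obtain z where z: "admissible z" "\<And>i. i \<le> length k \<Longrightarrow> cmod (z i) = 1" "X = psl_class (block_diag idx z)"
    by blast
  define P where "P = (\<Prod>i\<in>{1..length k}. z i ^ (k ! (i - 1)))"
  have "cmod P = 1"
    using z(2) by (auto simp: P_def norm_power simp flip: prod_norm intro!: prod.neutral)
  then have "P * cnj P = 1" using complex_norm_square[of P] by simp
  moreover have "z 0 * P = 1" using z(1) by (simp add: admissible_def P_def)
  ultimately have "z 0 = cnj P" by algebra
  then have "z 0 = (\<Prod>r\<in>{1..length k}. cnj (z r) ^ (k ! (r - 1)))" by (simp add: P_def)
  then have "block_diag idx z = block_diag idx
      (\<lambda>i. if i = 0 then (\<Prod>r\<in>{1..length k}. cnj (z r) ^ (k ! (r - 1))) else z i)"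
    by (simp add: block_diag_eq_iff)
  moreover have "\<forall>i\<in>{1..length k}. cmod (z i) = 1" using z(2) by simp
  ultimately have "X \<in> torus k idx"
    unfolding z(3) torus_def by (intro CollectI exI[of _ z] conjI) (simp_all only:)
  then show "X \<in> T_group k idx j" using z by (auto simp: T_group_def G_group_eq)
qed

lemma psl_act_admissible:
  assumes "admissible z" "w \<noteq> 0"
  shows "psl_act (psl_class (block_diag idx z)) (proj w) = proj (block_diag idx z *v w)"
  using assms label_le by (intro psl_act_class) (simp_all add: det_block_diag admissible_def)

text \<open>Dividing by \<open>z j\<close> changes only the scalar and turns the factor on block
  \<open>j\<close> into 1; on the blocks below \<open>j\<close> the vector vanishes. Logarithms of
  the remaining quotients are the parameters, imaginary when all moduli are 1.\<close>

lemma admissible_to_chart: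
  assumes z: "admissible z" and w: "w \<in> points"
  obtains u where "u \<in> param" "proj (block_diag idx z *v w) = chart w u"
    "(\<forall>i\<le>length k. cmod (z i) = 1) \<Longrightarrow> u \<in> im_param"
proof
  let ?u = "block_diag idx (\<lambda>i. if i \<le> j then 0 else Ln (z i / z j))"
  have nz: "z i \<noteq> 0" if "i \<le> length k" for i using z that by (simp add: admissible_def)
  note zj = nz[OF j_le]
  show u: "?u \<in> param" by (rule paramI) (auto simp: block_diag_def)
  have "dexp ?u w $ a = (inverse (z j) *s (block_diag idx z *v w)) $ a" for a
  proof -
    consider "fst (idx a) < j" | "fst (idx a) = j" | "j < fst (idx a)" by linarith
    then show ?thesis
    proof cases
      case 1
      then have "w $ a = 0" using w by (simp add: points_def)
      then show ?thesis by (simp add: dexp_def block_diag_mult)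
    next
      case 2
      then show ?thesis using zj by (simp add: dexp_def block_diag_mult) (simp add: block_diag_def)
    next
      case 3
      then show ?thesis using zj nz[OF label_le[of a]]
        by (simp add: dexp_def block_diag_mult divide_inverse mult_ac) (simp add: block_diag_def divide_inverse mult_ac)
    qed
  qed
  then have e: "dexp ?u w = inverse (z j) *s (block_diag idx z *v w)" by (simp add: vec_eq_iff)
  have "dexp ?u w \<noteq> 0" using points_nonzero[OF w] by simp
  then have "block_diag idx z *v w \<noteq> 0" unfolding e by auto
  then have "proj (block_diag idx z *v w) = proj (dexp ?u w)"
    using zj \<open>dexp ?u w \<noteq> 0\<close> proj_eq_iff e by (metis inverse_nonzero_iff_nonzero)
  then show "proj (block_diag idx z *v w) = chart w ?u" by (simp add: chart_def)
  assume "\<forall>i\<le>length k. cmod (z i) = 1"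
  then have "Re (Ln (z i / z j)) = 0" if "i \<le> length k" for i
    using that j_le nz zj by (simp add: norm_divide)
  then show "?u \<in> im_param" using u label_le by (auto simp: im_param_def block_diag_def)
qed

text \<open>The task is to reach determinant 1 without moving the point. For positive
  \<open>j\<close> the entry \<open>z 0\<close> acts on a vanishing coordinate and can absorb the
  determinant, while the entries strictly between 0 and \<open>j\<close> stay 1. For
  \<open>j = 0\<close> the whole matrix is rescaled by \<open>exp \<kappa>\<close>, which is
  invisible projectively. Both corrections have modulus 1 if \<open>u\<close> is imaginary.\<close>

lemma chart_to_admissible:
  assumes u: "u \<in> param" and w: "w \<in> points"
  obtains z where "admissible z" "proj (block_diag idx z *v w) = chart w u"
    "u \<in> im_param \<Longrightarrow> (\<forall>i\<le>length k. cmod (z i) = 1)"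
proof -
  \<comment> \<open>\<open>\<zeta>\<close> is total on the natural numbers; an index that labels no
    coordinate receives 0, which respects both further conditions.\<close>
  have "\<exists>\<zeta>. \<forall>i. (\<forall>a. fst (idx a) = i \<longrightarrow> u $ a $ a = \<zeta> i) \<and> (i \<le> j \<longrightarrow> \<zeta> i = 0)
      \<and> (u \<in> im_param \<longrightarrow> Re (\<zeta> i) = 0)"
  proof (rule choice, rule allI)
    fix i
    show "\<exists>z. (\<forall>a. fst (idx a) = i \<longrightarrow> u $ a $ a = z) \<and> (i \<le> j \<longrightarrow> z = 0) \<and> (u \<in> im_param \<longrightarrow> Re z = 0)"
    proof (cases "\<exists>a. fst (idx a) = i")
      case True
      then obtain a where a: "fst (idx a) = i" by blast
      have "u $ b $ b = u $ a $ a" if "fst (idx b) = i" for b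
        using paramD(2)[OF u, of b a] that a by simp
      moreover have "u $ a $ a = 0" if "i \<le> j" using paramD(3)[OF u, of a] that a by simp
      moreover have "Re (u $ a $ a) = 0" if "u \<in> im_param" using that by (simp add: im_param_def)
      ultimately show ?thesis by (intro exI[of _ "u $ a $ a"]) blast
    qed (auto intro!: exI[of _ 0])
  qed
  then obtain \<zeta> where \<zeta>: "\<And>a. u $ a $ a = \<zeta> (fst (idx a))" "\<And>i. i \<le> j \<Longrightarrow> \<zeta> i = 0"
    "\<And>i. u \<in> im_param \<Longrightarrow> Re (\<zeta> i) = 0" by blast
  show thesis
  proof (cases "j = 0")
    case False
    define Q where "Q = (\<Prod>i\<in>{1..length k}. exp (\<zeta> i) ^ (k ! (i - 1)))"
    define z where "z i = (if i = 0 then inverse Q else exp (\<zeta> i))" for i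
    have Q: "Q \<noteq> 0" by (simp add: Q_def)
    have "(\<Prod>i\<in>{1..length k}. z i ^ (k ! (i - 1))) = Q" unfolding Q_def z_def by (intro prod.cong) auto
    then have "admissible z" using Q \<zeta>(2) by (auto simp: admissible_def z_def)
    moreover have "block_diag idx z *v w = dexp u w"
      using w False by (auto simp: block_diag_mult dexp_def vec_eq_iff \<zeta>(1) z_def points_def)
    then have "proj (block_diag idx z *v w) = chart w u" by (simp add: chart_def)
    moreover have "\<forall>i\<le>length k. cmod (z i) = 1" if "u \<in> im_param"
    proof -
      have "cmod Q = 1" using \<zeta>(3)[OF that] by (auto simp: Q_def norm_power simp flip: prod_norm intro!: prod.neutral)
      then show ?thesis using \<zeta>(3)[OF that] by (auto simp: z_def norm_inverse)
    qed
    ultimately show thesis by (rule that)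
  next
    case True
    define S where "S = (\<Sum>i\<in>{1..length k}. of_nat (k ! (i - 1)) * \<zeta> i)"
    define N where "N = (\<Sum>i\<in>{1..length k}. k ! (i - 1))"
    \<comment> \<open>\<open>Suc N\<close> is the size of the matrix, the extra 1 being block 0; so
      \<open>\<kappa>\<close> solves \<open>\<kappa> + S + N * \<kappa> = 0\<close>.\<close>
    define \<kappa> where "\<kappa> = - S / of_nat (Suc N)"
    define z where "z i = exp (\<zeta> i + \<kappa>)" for i
    have "(\<Prod>i\<in>{1..length k}. z i ^ (k ! (i - 1))) = exp (\<Sum>i\<in>{1..length k}. of_nat (k ! (i - 1)) * (\<zeta> i + \<kappa>))"
      unfolding z_def by (simp add: exp_sum exp_of_nat_mult)
    also have "(\<Sum>i\<in>{1..length k}. of_nat (k ! (i - 1)) * (\<zeta> i + \<kappa>)) = S + of_nat N * \<kappa>"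
      by (simp add: S_def N_def algebra_simps sum.distrib sum_distrib_left)
    finally have "z 0 * (\<Prod>i\<in>{1..length k}. z i ^ (k ! (i - 1))) = exp (\<kappa> + (S + of_nat N * \<kappa>))"
      using \<zeta>(2)[of 0] True by (simp add: z_def exp_add)
    moreover have "\<kappa> + (S + of_nat N * \<kappa>) = 0"
    proof -
      have "of_nat (Suc N) * \<kappa> = - S" unfolding \<kappa>_def by (simp del: of_nat_Suc)
      then show ?thesis by (simp add: algebra_simps)
    qed
    ultimately have "z 0 * (\<Prod>i\<in>{1..length k}. z i ^ (k ! (i - 1))) = 1" by simp
    then have "admissible z" unfolding admissible_def using True by (simp add: z_def)
    moreover have e: "block_diag idx z *v w = exp \<kappa> *s dexp u w"
      by (simp add: block_diag_mult dexp_def vec_eq_iff \<zeta>(1) z_def exp_add)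
    have "proj (block_diag idx z *v w) = chart w u"
    proof -
      have "dexp u w \<noteq> 0" using points_nonzero[OF w] by simp
      moreover from this have "exp \<kappa> *s dexp u w \<noteq> 0" by (simp add: vec_eq_iff)
      ultimately have "proj (dexp u w) = proj (exp \<kappa> *s dexp u w)"
        using proj_eq_iff exp_not_eq_zero by blast
      then show ?thesis unfolding e chart_def by simp
    qed
    moreover have "\<forall>i\<le>length k. cmod (z i) = 1" if "u \<in> im_param"
    proof -
      have "Re S = 0" using \<zeta>(3)[OF that] by (simp add: S_def)
      then have "Re \<kappa> = 0" by (simp add: \<kappa>_def Re_divide_of_nat del: of_nat_Suc)
      then show ?thesis using \<zeta>(3)[OF that] by (simp add: z_def)
    qed
    ultimately show thesis by (rule that)
  qed
qed

lemma orbit_G: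
  assumes "w \<in> points"
  shows "orbit (G_group k idx j) (proj w) = chart w ` param"
proof (intro set_eqI iffI)
  note w = points_nonzero[OF assms]
  fix P assume "P \<in> orbit (G_group k idx j) (proj w)"
  then obtain z where z: "admissible z" "P = proj (block_diag idx z *v w)"
    using psl_act_admissible w by (auto simp: orbit_def G_group_eq)
  then show "P \<in> chart w ` param" using admissible_to_chart[OF z(1) assms] by auto
next
  note w = points_nonzero[OF assms]
  fix P assume "P \<in> chart w ` param"
  then obtain u where u: "u \<in> param" "P = chart w u" by blast
  obtain z where z: "admissible z" "proj (block_diag idx z *v w) = chart w u"
    using chart_to_admissible[OF u(1) assms] by blast
  have "P = psl_act (psl_class (block_diag idx z)) (proj w)" using psl_act_admissible[OF z(1) w] z(2) u(2) by simp
  then show "P \<in> orbit (G_group k idx j) (proj w)" using z(1) unfolding orbit_def G_group_eq by blast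
qed

lemma orbit_T:
  assumes "w \<in> points"
  shows "orbit (T_group k idx j) (proj w) = chart w ` im_param"
proof (intro set_eqI iffI)
  note w = points_nonzero[OF assms]
  fix P assume "P \<in> orbit (T_group k idx j) (proj w)"
  then obtain z where z: "admissible z" "\<forall>i\<le>length k. cmod (z i) = 1" "P = proj (block_diag idx z *v w)"
    using psl_act_admissible w by (auto simp: orbit_def T_group_eq)
  then show "P \<in> chart w ` im_param" using admissible_to_chart[OF z(1) assms] by auto
next
  note w = points_nonzero[OF assms]
  fix P assume "P \<in> chart w ` im_param"
  then obtain u where u: "u \<in> im_param" "P = chart w u" by blast
  have "u \<in> param" using u(1) by (simp add: im_param_def)
  then obtain z where z: "admissible z" "proj (block_diag idx z *v w) = chart w u" "\<forall>i\<le>length k. cmod (z i) = 1"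
    using chart_to_admissible[OF _ assms] u(1) by blast
  have "P = psl_act (psl_class (block_diag idx z)) (proj w)" using psl_act_admissible[OF z(1) w] z(2) u(2) by simp
  then show "P \<in> orbit (T_group k idx j) (proj w)" using z(1,3) unfolding orbit_def T_group_eq by blast
qed

lemma stratum_points:
  assumes "P \<in> stratum k idx j"
  obtains w where "w \<in> points" "P = proj w"
proof -
  obtain w where w: "P = proj w" "\<And>i. j \<le> i \<Longrightarrow> i \<le> length k \<Longrightarrow> \<not> block_zero idx w i"
      "\<And>i. i < j \<Longrightarrow> block_zero idx w i"
    using assms unfolding stratum_def by fastforce
  have "\<exists>b. fst (idx b) = fst (idx a) \<and> w $ b \<noteq> 0" if "j \<le> fst (idx a)" for a
    using w(2)[OF that label_le] by (auto simp: block_zero_def block_def)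
  moreover have "w $ a = 0" if "fst (idx a) < j" for a
    using w(3)[OF that] by (auto simp: block_zero_def block_def)
  moreover have "\<exists>a. fst (idx a) = j" using label_surj j_le by blast
  ultimately have "w \<in> points" by (simp add: points_def)
  then show thesis using that w(1) by blast
qed

text \<open>A torus element multiplies block \<open>i\<close> by one phase \<open>E\<close> and
  keeps all block norms. The symbol picks up \<open>E\<close> to the sum of \<open>p\<close> over
  the block times \<open>cnj E\<close> to the sum of \<open>q\<close>; these sums agree, so the
  factor is 1. Vanishing of blocks, hence definedness, is preserved too.\<close>

lemma symbol_constant:
  assumes \<phi>: "\<phi> \<in> symbols k h idx" and w: "w \<noteq> 0"
  shows "constant_on_leaf \<phi> (chart w ` im_param)"
proof -
  obtain A :: "real list \<Rightarrow> complex" and p q :: "'m \<Rightarrow> nat" where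
    pq: "\<And>i. i \<le> length k \<Longrightarrow> (\<Sum>b\<in>block idx i. p b) = (\<Sum>b\<in>block idx i. q b)" and
    val: "\<And>w. w \<noteq> 0 \<Longrightarrow> \<phi> (proj w) =
            (if \<forall>j\<le>length k. (\<exists>i\<in>block idx j. p i \<noteq> 0 \<or> q i \<noteq> 0) \<longrightarrow> \<not> block_zero idx w j
             then Some (A (map (block_norm idx w) [0..<Suc (length k)]) *
               (\<Prod>j\<le>length k. (\<Prod>i\<in>block idx j. (w $ i / of_real (block_norm idx w j)) ^ p i) *
                              (\<Prod>i\<in>block idx j. (cnj (w $ i) / of_real (block_norm idx w j)) ^ q i)))
             else None)"
    using \<phi> unfolding symbols_def by blast
  have "\<phi> (chart w a) = \<phi> (proj w)" if a: "a \<in> im_param" for a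
  proof -
    have ap: "a \<in> param" using a by (simp add: im_param_def)
    have ca: "cmod (exp (a $ b $ b)) = 1" for b using a by (simp add: im_param_def)
    have bz: "block_zero idx (dexp a w) i = block_zero idx w i" for i
      by (simp add: block_zero_def dexp_def)
    have "cmod (dexp a w $ b) = cmod (w $ b)" for b using ca by (simp add: dexp_def norm_mult)
    then have bn: "block_norm idx (dexp a w) = block_norm idx w"
      by (simp add: block_norm_def fun_eq_iff)
    have "(\<Prod>b\<in>block idx i. (dexp a w $ b / of_real (block_norm idx w i)) ^ p b) *
          (\<Prod>b\<in>block idx i. (cnj (dexp a w $ b) / of_real (block_norm idx w i)) ^ q b)
        = (\<Prod>b\<in>block idx i. (w $ b / of_real (block_norm idx w i)) ^ p b) *
          (\<Prod>b\<in>block idx i. (cnj (w $ b) / of_real (block_norm idx w i)) ^ q b)"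
      if i: "i \<le> length k" for i
    proof -
      obtain b0 where b0: "fst (idx b0) = i" using label_surj[OF i] by blast
      define E where "E = exp (a $ b0 $ b0)"
      have E: "exp (a $ b $ b) = E" if "b \<in> block idx i" for b
        using paramD(2)[OF ap, of b b0] that b0 by (simp add: E_def block_def)
      have "E * cnj E = 1" using ca[of b0] complex_norm_square[of E] by (simp add: E_def)
      then have EE: "E ^ m * cnj E ^ m = 1" for m by (metis power_mult_distrib power_one)
      have "(\<Prod>b\<in>block idx i. (dexp a w $ b / of_real (block_norm idx w i)) ^ p b)
        = (\<Prod>b\<in>block idx i. E ^ p b * (w $ b / of_real (block_norm idx w i)) ^ p b)"
        by (intro prod.cong refl) (simp add: dexp_def E flip: power_mult_distrib)
      moreover have "(\<Prod>b\<in>block idx i. (cnj (dexp a w $ b) / of_real (block_norm idx w i)) ^ q b)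
        = (\<Prod>b\<in>block idx i. cnj E ^ q b * (cnj (w $ b) / of_real (block_norm idx w i)) ^ q b)"
        by (intro prod.cong refl) (simp add: dexp_def E flip: power_mult_distrib)
      ultimately show ?thesis
        using EE[of "\<Sum>b\<in>block idx i. q b"] pq[OF i] by (simp add: prod.distrib flip: power_sum)
    qed
    then have "(\<Prod>i\<le>length k. (\<Prod>b\<in>block idx i. (dexp a w $ b / of_real (block_norm idx w i)) ^ p b) *
          (\<Prod>b\<in>block idx i. (cnj (dexp a w $ b) / of_real (block_norm idx w i)) ^ q b))
        = (\<Prod>i\<le>length k. (\<Prod>b\<in>block idx i. (w $ b / of_real (block_norm idx w i)) ^ p b) *
          (\<Prod>b\<in>block idx i. (cnj (w $ b) / of_real (block_norm idx w i)) ^ q b))"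
      by (intro prod.cong) auto
    then show ?thesis using w val[of w] val[of "dexp a w"] by (simp only: chart_def bz bn dexp_nonzero not_False_eq_True)
  qed
  then show ?thesis unfolding constant_on_leaf_def by fastforce
qed

end

theorem theorem5p7:
  fixes n j :: nat and k h :: "nat list" and idx :: "'m::finite \<Rightarrow> nat \<times> nat"
    and F :: "(complex^'m^'m) set"
  assumes "partition_of n k"
    and "length h = length k"
    and "\<forall>i<length k. 1 \<le> h ! i \<and> h ! i \<le> k ! i - 1"
    and "block_labelling k idx"
    and "j \<le> length k"
    and "F \<in> orbit (G_group k idx j) ` stratum k idx j"
  defines "\<O> \<equiv> orbit (T_group k idx j) ` F"
  shows "complex_submanifold fs_J F
    \<and> (riemannian_foliation F fs_metric \<O>
        \<and> (\<forall>\<phi>\<in>symbols k h idx. \<forall>L\<in>\<O>. constant_on_leaf \<phi> L))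
    \<and> (\<exists>\<J>. (foliation F \<J>
            \<and> (\<forall>x\<in>F. leaf_tangent \<J> x = leaf_normal F fs_metric \<O> x)
            \<and> totally_geodesic_foliation F fs_metric \<J>)
        \<and> lagrangian_frame F fs_metric fs_J \<O> \<J>)"
proof -
  interpret partition_action n j k idx using assms by unfold_locales
  obtain v where v: "v \<in> points" "F = orbit (G_group k idx j) (proj v)"
    using assms(6) stratum_points by blast
  interpret block_orbit "\<lambda>a. fst (idx a)" j v using v(1) by unfold_locales
  have F: "F = orb" using v(2) orbit_G[OF v(1)] by (simp add: orb_def)
  have "proj ` lifts = orb" using proj_lifts orb_lifts by blast
  then have "\<O> = (\<lambda>w. orbit (T_group k idx j) (proj w)) ` lifts"
    unfolding \<O>_def F by (metis image_image)
  then have O: "\<O> = leaves im_param"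
    unfolding leaves_def using orbit_T[OF lifts_points] by simp
  have "complex_submanifold fs_J F"
    unfolding complex_submanifold_def F using submanifold_orb fs_J_tangent by blast
  moreover have "constant_on_leaf \<phi> L" if "\<phi> \<in> symbols k h idx" "L \<in> \<O>" for \<phi> L
    using that symbol_constant lifts_nonzero unfolding O leaves_def by blast
  \<comment> \<open>\<open>leaves re_param\<close> is the witness for the foliation
    \<open>\<J>\<close>.\<close>
  moreover have "foliation F (leaves re_param)" unfolding F by (rule foliation_leaves[OF leaf_space_re])
  moreover have "\<forall>x\<in>F. leaf_tangent (leaves re_param) x = leaf_normal F fs_metric \<O> x"
    unfolding F O using leaf_tangent_re by blast
  ultimately show ?thesis
    using riemannian_foliation_im totally_geodesic_foliation_re lagrangian_frame_leaves
    unfolding F O by blast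
qed

end
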